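(* Let $A\in\mathbb{C}^{n\times n}$ with $f(A)$ well defined, and consider $m$ iterations of the inexact Lanczos bidiagonalization, with the resulting quantities as described in the context. Let $k\le m$ and let $(\theta^{(2k)},q^{(2k)})$ be an eigenpair of $\widetilde{\mathcal{B}}_{2k}$, with $q^{(2k)}=[x;y]$ of unit norm, $x,y\in\mathbb{C}^k$. Let $\widetilde q=[x;0;y;0]\in\mathbb{C}^{2m}$, where the zero vectors have length $m-k$, let $Y\in\mathbb{C}^{2m\times(2m-1)}$ be chosen such that $[\widetilde q,Y]$ is unitary, and let $\underline{\widetilde{\mathcal{B}}}_{2m}=Y^*\widetilde{\mathcal{B}}_{2m}Y$. Let $s_{2m}^*=\widetilde q^*\widetilde{\mathcal{B}}_{2m}-\theta^{(2k)}\widetilde q^*$, let $\delta_{2m,2k}=\sigma_{\min}(\underline{\widetilde{\mathcal{B}}}_{2m}-\theta^{(2k)}I)>0$, and let $r_{2k}=t_{k+1,k}\begin{bmatrix}0\\ v_{k+1}\end{bmatrix}e_k^*q^{(2k)}$ with $e_k\in\mathbb{R}^{2k}$. If $$\|r_{2k}\|<\frac{\delta_{2m,2k}^2}{4\|s_{2m}\|},$$ then there exists a unit norm eigenvector $q=[x_1;x_2;y_1;y_2]$ of $\widetilde{\mathcal{B}}_{2m}$, with $x_1,y_1\in\mathbb{C}^k$ and $x_2,y_2\in\mathbb{C}^{m-k}$, such that $$\left\|\begin{bmatrix}x_2\\ y_2\end{bmatrix}\right\|\le\frac{\tau}{\sqrt{1+\tau^2}},$$ with $\tau\in\mathbb{R}$,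 $0\le\tau<2\,\dfrac{\|r_{2k}\|}{\delta_{2m,2k}}$. Moreover, if $\theta$ is the eigenvalue associated with $q$, then $$|\theta-\theta^{(2k)}|\le\|s_{2m}\|\,\tau.$$
   Context: $\|\cdot\|$ is the Euclidean vector norm, $^*$ the conjugate transpose, $e_j$ the $j$-th column of the identity matrix of appropriate size, $\sigma_{\min}$ the smallest singular value, and $[a;b]$ denotes the column vector obtained by stacking $a$ on top of $b$. Inexact Lanczos bidiagonalization. After $m$ iterations one has matrices $U_m=[u_1,\dots,u_m]\in\mathbb{C}^{n\times m}$ and $[V_m,v_{m+1}]=[v_1,\dots,v_{m+1}]\in\mathbb{C}^{n\times(m+1)}$, each with orthonormal columns, an upper triangular matrix $M_m\in\mathbb{C}^{m\times m}$, an upper Hessenberg matrix $T_m\in\mathbb{C}^{m\times m}$ and a scalar $t_{m+1,m}$ such that $$f(A)V_m+G_m^{(1)}=U_mM_m,\qquad f(A)^*U_m+G_m^{(2)}=V_mT_m+t_{m+1,m}v_{m+1}e_m^*,$$ where the columns of $G_m^{(1)},G_m^{(2)}\in\mathbb{C}^{n\times m}$ are the errors made in the approximate computation of $f(A)v_j$ and $f(A)^*u_j$, $j=1,\dots,m$, respectively. For $k<m$, $t_{k+1,k}$ denotes the $(k+1,k)$ entry of $T_m$. For $1\le k\le m$, $$\widetilde{\mathcal{B}}_{2k}=\begin{bmatrix} 0 & M_k \\ T_k & 0 \end{bmatrix}\in\mathbb{C}^{2k\times 2k},$$ where $M_k,T_k$ are the leading $k\times k$ submatrices of $M_m,T_m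$.
   Formalization: When r_{2k}=0 the condition 0≤τ<2‖r_{2k}‖/δ has no solution, so there the formal statement takes τ=0 instead; when s_{2m}=0 the smallness condition on ‖r_{2k}‖ is taken to hold (bound read as +∞). *)

theory Defs
  imports
    "HOL-Analysis.Derivative"
    "Jordan_Normal_Form.Jordan_Normal_Form_Existence"
begin

unbundle no vec_syntax
no_notation inner (infix "\<bullet>" 70)

definition vnorm :: "complex vec \<Rightarrow> real" where
  "vnorm v = sqrt (\<Sum>i<dim_vec v. (cmod (v $ i))\<^sup>2)"

definition orthonormal_cols :: "complex mat \<Rightarrow> bool" where
  "orthonormal_cols U \<longleftrightarrow> mat_adjoint U * U = 1\<^sub>m (dim_col U)"

definition unitary_mat :: "complex mat \<Rightarrow> bool" where
  "unitary_mat U \<longleftrightarrow> dim_row U = dim_col U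
     \<and> mat_adjoint U * U = 1\<^sub>m (dim_col U) \<and> U * mat_adjoint U = 1\<^sub>m (dim_row U)"

definition upper_hessenberg :: "complex mat \<Rightarrow> bool" where
  "upper_hessenberg T \<longleftrightarrow> (\<forall>i<dim_row T. \<forall>j<dim_col T. Suc j < i \<longrightarrow> T $$ (i,j) = 0)"

text \<open>Singular values as the nonnegative square roots of the eigenvalues of \<open>A\<^sup>* A\<close>. For a matrix
  with fewer rows than columns this set contains an additional 0; it is only used for square matrices.\<close>

definition singular_values :: "complex mat \<Rightarrow> real set" where
  "singular_values A = {\<sigma>. 0 \<le> \<sigma> \<and> eigenvalue (mat_adjoint A * A) (complex_of_real (\<sigma>\<^sup>2))}"

definition sigma_min :: "complex mat \<Rightarrow> real" where
  "sigma_min A = Min (singular_values A)"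

definition leading_submat :: "nat \<Rightarrow> complex mat \<Rightarrow> complex mat" where
  "leading_submat k A = mat k k (\<lambda>(i,j). A $$ (i,j))"

definition Btilde :: "nat \<Rightarrow> complex mat \<Rightarrow> complex mat \<Rightarrow> complex mat" where
  "Btilde k M T =
     four_block_mat (0\<^sub>m k k) (leading_submat k M) (leading_submat k T) (0\<^sub>m k k)"

text \<open>Matrix functions in the sense of the Jordan canonical form: \<open>f(A)\<close> is well defined if, for
  every Jordan block of size \<open>k\<close> with eigenvalue \<open>a\<close>, the values \<open>f(a), f'(a), \<dots>, f\<^sup>(\<^sup>k\<^sup>-\<^sup>1\<^sup>)(a)\<close> exist.
  Since \<open>deriv\<close> is total, existence of the lower derivatives near the point has to be demanded
  explicitly.\<close>

primrec times_differentiable :: "nat \<Rightarrow> (complex \<Rightarrow> complex) \<Rightarrow> complex \<Rightarrow> bool" where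
  "times_differentiable 0 f a \<longleftrightarrow> True"
| "times_differentiable (Suc l) f a \<longleftrightarrow>
     (\<forall>\<^sub>F z in nhds a. times_differentiable l f z) \<and> ((deriv ^^ l) f) field_differentiable (at a)"

definition mat_fun_well_defined :: "(complex \<Rightarrow> complex) \<Rightarrow> complex mat \<Rightarrow> bool" where
  "mat_fun_well_defined f A \<longleftrightarrow>
     (\<forall>n_as. jordan_nf A n_as \<longrightarrow> (\<forall>(k, a) \<in> set n_as. times_differentiable (k - 1) f a))"

definition jordan_block_fun :: "(complex \<Rightarrow> complex) \<Rightarrow> nat \<Rightarrow> complex \<Rightarrow> complex mat" where
  "jordan_block_fun f k a =
     mat k k (\<lambda>(i,j). if i \<le> j then (deriv ^^ (j - i)) f a / fact (j - i) else 0)"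

text \<open>If \<open>f(A)\<close> is well defined, the result does not depend on the chosen Jordan decomposition
  \<open>A = P J Q\<close>, \<open>Q = P\<^sup>-\<^sup>1\<close>.\<close>

definition mat_fun :: "(complex \<Rightarrow> complex) \<Rightarrow> complex mat \<Rightarrow> complex mat" where
  "mat_fun f A = (SOME F. \<exists>n_as P Q. 0 \<notin> fst ` set n_as \<and> similar_mat_wit A (jordan_matrix n_as) P Q
     \<and> F = P * diag_block_mat (map (\<lambda>(k, a). jordan_block_fun f k a) n_as) * Q)"

text \<open>The outcome of \<open>m\<close> iterations for an \<open>n \<times> n\<close> matrix \<open>F\<close>. Here \<open>v\<close> is \<open>v\<^sub>m\<^sub>+\<^sub>1\<close> and \<open>t\<close> is
  \<open>t\<^sub>m\<^sub>+\<^sub>1\<^sub>,\<^sub>m\<close>; indices of the library are 0-based, so \<open>e\<^sub>m\<close> is \<open>unit_vec m (m - 1)\<close>.\<close>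

definition inexact_lanczos_bidiag ::
  "nat \<Rightarrow> nat \<Rightarrow> complex mat \<Rightarrow> complex mat \<Rightarrow> complex mat \<Rightarrow> complex vec \<Rightarrow> complex mat \<Rightarrow> complex mat
     \<Rightarrow> complex \<Rightarrow> complex mat \<Rightarrow> complex mat \<Rightarrow> bool" where
  "inexact_lanczos_bidiag n m F U V v M T t G1 G2 \<longleftrightarrow>
     U \<in> carrier_mat n m \<and> orthonormal_cols U
     \<and> V \<in> carrier_mat n m \<and> v \<in> carrier_vec n \<and> orthonormal_cols (mat_of_cols n (cols V @ [v]))
     \<and> M \<in> carrier_mat m m \<and> upper_triangular M
     \<and> T \<in> carrier_mat m m \<and> upper_hessenberg T
     \<and> G1 \<in> carrier_mat n m \<and> G2 \<in> carrier_mat n m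
     \<and> F * V + G1 = U * M
     \<and> mat_adjoint F * U + G2
         = V * T + t \<cdot>\<^sub>m (mat_of_cols n [v] * mat_of_rows m [conjugate (unit_vec m (m - 1))])"

end

theory Submission
  imports Defs "Jordan_Normal_Form.Spectral_Radius"
begin

text \<open>In the basis \<open>[qt, Y]\<close> the matrix \<open>B\<close> takes the form
  \<open>[\<theta>\<^sub>k, h\<^sup>*; g, B']\<close> with \<open>h = Y\<^sup>* s\<close> and \<open>g = Y\<^sup>* u\<close>, where \<open>u = B qt - \<theta>\<^sub>k qt\<close>.
  As \<open>M\<close> is triangular and \<open>T\<close> is Hessenberg, \<open>u\<close> has a single entry, of modulus at most the norm
  of \<open>r\<close>, in a position where \<open>qt\<close> vanishes.
  The vector \<open>qt + Y p\<close> is an eigenvector for \<open>\<theta>\<^sub>k + h\<^sup>* p\<close> iff \<open>p\<close> solves the Riccati equation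
  \<open>(B' - \<theta>\<^sub>k) p = (h\<^sup>* p) p - g\<close>. The inverse of \<open>B' - \<theta>\<^sub>k\<close> has norm \<open>1/\<delta>\<close>, so the hypothesis on
  \<open>r\<close> makes the associated fixed-point map a contraction of a ball of radius less than twice the
  norm of \<open>r\<close> over \<open>\<delta>\<close> (Stewart). Then \<open>\<tau>\<close> is the norm of \<open>p\<close>, and normalising
  \<open>qt + Y p\<close> gives \<open>q\<close>.\<close>

section \<open>Norms and adjoints of complex vectors and matrices\<close>

lemma vnorm_eq_L2_set: "vnorm v = L2_set (\<lambda>i. cmod (v $ i)) {..<dim_vec v}"
  by (simp add: vnorm_def L2_set_def)

lemma vnorm_nonneg [simp]: "0 \<le> vnorm v"
  by (simp add: vnorm_eq_L2_set)

lemma vnorm_power2: "(vnorm v)\<^sup>2 = (\<Sum>i<dim_vec v. (cmod (v $ i))\<^sup>2)"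
  by (simp add: vnorm_def sum_nonneg)

lemma cscalar_prod_self: "v \<bullet>c v = complex_of_real ((vnorm v)\<^sup>2)"
  by (simp add: vnorm_power2 scalar_prod_def atLeast0LessThan complex_norm_square del: of_real_power)

lemma vnorm_zero [simp]: "vnorm (0\<^sub>v n) = 0"
  by (simp add: vnorm_def)

lemma vnorm_eq_0_iff: "v \<in> carrier_vec n \<Longrightarrow> vnorm v = 0 \<longleftrightarrow> v = 0\<^sub>v n"
  by (auto simp: vnorm_eq_L2_set L2_set_eq_0_iff)

lemma cmod_index_le_vnorm: "i < dim_vec v \<Longrightarrow> cmod (v $ i) \<le> vnorm v"
  unfolding vnorm_eq_L2_set by (rule member_le_L2_set) auto

lemma vnorm_smult [simp]: "vnorm (c \<cdot>\<^sub>v v) = cmod c * vnorm v"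
  by (simp add: vnorm_eq_L2_set norm_mult L2_set_right_distrib cong: L2_set_cong_simp)

lemma vnorm_uminus [simp]: "vnorm (- v) = vnorm v"
  by (simp add: vnorm_def)

lemma vnorm_triangle:
  assumes "u \<in> carrier_vec n" "v \<in> carrier_vec n"
  shows "vnorm (u + v) \<le> vnorm u + vnorm v"
proof -
  have "vnorm (u + v) \<le> L2_set (\<lambda>i. cmod (u $ i) + cmod (v $ i)) {..<n}"
    unfolding vnorm_eq_L2_set using assms by (auto intro!: L2_set_mono norm_triangle_ineq)
  also have "\<dots> \<le> vnorm u + vnorm v"
    unfolding vnorm_eq_L2_set using assms L2_set_triangle_ineq by auto
  finally show ?thesis .
qed

lemma vnorm_unit_vec: "i < n \<Longrightarrow> vnorm (unit_vec n i) = 1"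
  by (simp add: vnorm_def if_distrib[of cmod] if_distrib[of "\<lambda>x. x ^ 2"] cong: if_cong)

lemma cscalar_prod_append:
  fixes u v u' v' :: "complex vec"
  assumes "dim_vec u' = dim_vec u" "dim_vec v' = dim_vec v"
  shows "(u @\<^sub>v v) \<bullet>c (u' @\<^sub>v v') = u \<bullet>c u' + v \<bullet>c v'"
proof -
  have "conjugate (u' @\<^sub>v v') = conjugate u' @\<^sub>v conjugate v'" by (intro eq_vecI) auto
  moreover have "conjugate u' \<in> carrier_vec (dim_vec u)" "conjugate v' \<in> carrier_vec (dim_vec v)"
    using assms by (auto intro: carrier_vecI)
  ultimately show ?thesis
    by (simp add: scalar_prod_append[of u "dim_vec u" v "dim_vec v"])
qed

lemma vnorm_append_power2: "(vnorm (u @\<^sub>v v))\<^sup>2 = (vnorm u)\<^sup>2 + (vnorm v)\<^sup>2"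
proof -
  have "(u @\<^sub>v v) \<bullet>c (u @\<^sub>v v) = u \<bullet>c u + v \<bullet>c v" by (simp add: cscalar_prod_append)
  then show ?thesis
    unfolding cscalar_prod_self of_real_add[symmetric] of_real_eq_iff .
qed

lemma cmod_cscalar_prod_le:
  assumes "u \<in> carrier_vec n" "v \<in> carrier_vec n"
  shows "cmod (u \<bullet>c v) \<le> vnorm u * vnorm v"
proof -
  have "cmod (u \<bullet>c v) \<le> (\<Sum>i<n. \<bar>cmod (u $ i)\<bar> * \<bar>cmod (v $ i)\<bar>)"
    using assms unfolding scalar_prod_def
    by (auto intro!: sum_norm_le simp: norm_mult atLeast0LessThan)
  also have "\<dots> \<le> vnorm u * vnorm v"
    using L2_set_mult_ineq[of "\<lambda>i. cmod (u $ i)" "\<lambda>i. cmod (v $ i)" "{..<n}"] assms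
    by (simp add: vnorm_eq_L2_set)
  finally show ?thesis .
qed

lemma cscalar_prod_commute:
  fixes u v :: "complex vec"
  assumes "u \<in> carrier_vec n" "v \<in> carrier_vec n"
  shows "v \<bullet>c u = cnj (u \<bullet>c v)"
  using assms by (simp add: scalar_prod_def mult.commute)

lemma vnorm_add_power2:
  assumes "u \<in> carrier_vec n" "v \<in> carrier_vec n"
  shows "(vnorm (u + v))\<^sup>2 = (vnorm u)\<^sup>2 + 2 * Re (u \<bullet>c v) + (vnorm v)\<^sup>2"
proof -
  have "(vnorm (u + v))\<^sup>2 = Re ((u + v) \<bullet>c (u + v))" by (simp add: cscalar_prod_self)
  also have "(u + v) \<bullet>c (u + v) = u \<bullet>c u + v \<bullet>c u + (u \<bullet>c v + v \<bullet>c v)"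
    using assms by (simp add: conjugate_add_vec[of _ n] add_scalar_prod_distrib[of _ n]
        scalar_prod_add_distrib[of _ n])
  finally show ?thesis
    by (simp add: cscalar_prod_self cscalar_prod_commute[OF assms])
qed

section \<open>Adjoints, boundedness and inverses of matrices\<close>

lemma dim_mat_adjoint [simp]:
  "dim_row (mat_adjoint A) = dim_col A" "dim_col (mat_adjoint A) = dim_row A"
  by (simp_all add: mat_adjoint_def)

lemma mat_adjoint_carrier [simp]:
  "A \<in> carrier_mat n m \<Longrightarrow> mat_adjoint A \<in> carrier_mat m n"
  by auto

lemma index_mat_adjoint [simp]:
  "i < dim_col A \<Longrightarrow> j < dim_row A \<Longrightarrow> mat_adjoint A $$ (i, j) = conjugate (A $$ (j, i))"
  by (simp add: mat_adjoint_def mat_of_rows_index)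

lemma cscalar_prod_mult_mat_vec:
  fixes A :: "complex mat"
  assumes "A \<in> carrier_mat n m" "u \<in> carrier_vec m" "w \<in> carrier_vec n"
  shows "(A *\<^sub>v u) \<bullet>c w = u \<bullet>c (mat_adjoint A *\<^sub>v w)"
proof -
  have "(A *\<^sub>v u) \<bullet>c w = (\<Sum>i<n. \<Sum>j<m. A $$ (i,j) * u $ j * cnj (w $ i))"
    using assms by (simp add: scalar_prod_def atLeast0LessThan sum_distrib_right)
  also have "\<dots> = (\<Sum>j<m. \<Sum>i<n. A $$ (i,j) * u $ j * cnj (w $ i))"
    by (rule sum.swap)
  also have "\<dots> = u \<bullet>c (mat_adjoint A *\<^sub>v w)"
    using assms
    by (simp add: scalar_prod_def atLeast0LessThan sum_distrib_left mult_ac)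
  finally show ?thesis .
qed

lemma mat_adjoint_adjoint [simp]:
  fixes A :: "complex mat"
  shows "mat_adjoint (mat_adjoint A) = A"
  by (intro eq_matI) auto

lemma index_mat_adjoint_mult_vec:
  fixes A :: "complex mat"
  assumes "A \<in> carrier_mat n m" "w \<in> carrier_vec n" "j < m"
  shows "(mat_adjoint A *\<^sub>v w) $ j = w \<bullet>c col A j"
  using assms by (simp add: scalar_prod_def mult.commute)

text \<open>Cauchy-Schwarz in each row gives the sum of the row norms as a bound. The constant is
  crude, since it only has to exist; adding 1 makes it strictly positive even for a zero or empty
  matrix, so that it may be divided by.\<close>

lemma mult_mat_vec_bounded:
  assumes "A \<in> carrier_mat n m"
  obtains C where "C > 0" "\<And>u. u \<in> carrier_vec m \<Longrightarrow> vnorm (A *\<^sub>v u) \<le> C * vnorm u"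
proof
  let ?C = "\<Sum>i<n. vnorm (conjugate (row A i))"
  show "?C + 1 > 0" by (simp add: sum_nonneg add_nonneg_pos)
  fix u :: "complex vec" assume u: "u \<in> carrier_vec m"
  have "vnorm (A *\<^sub>v u) \<le> (\<Sum>i<n. \<bar>cmod ((A *\<^sub>v u) $ i)\<bar>)"
    using L2_set_le_sum_abs[of "\<lambda>i. cmod ((A *\<^sub>v u) $ i)" "{..<n}"] assms
    by (simp add: vnorm_eq_L2_set)
  also have "\<dots> \<le> (\<Sum>i<n. vnorm (conjugate (row A i)) * vnorm u)"
  proof (rule sum_mono)
    fix i assume i: "i \<in> {..<n}"
    have "(A *\<^sub>v u) $ i = u \<bullet>c conjugate (row A i)"
      using assms u i by (simp add: comm_scalar_prod[of _ m])
    then show "\<bar>cmod ((A *\<^sub>v u) $ i)\<bar> \<le> vnorm (conjugate (row A i)) * vnorm u"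
      using cmod_cscalar_prod_le[of u m "conjugate (row A i)"] assms u i by (simp add: mult.commute)
  qed
  also have "\<dots> \<le> (?C + 1) * vnorm u"
    by (simp add: sum_distrib_right[symmetric] mult_right_mono)
  finally show "vnorm (A *\<^sub>v u) \<le> (?C + 1) * vnorm u" .
qed

text \<open>Serves twice: by contradiction it yields a kernel vector at the minimum of the Rayleigh
  quotient, and directly it inverts the operator of the Riccati equation.\<close>

lemma injective_mat_inverse:
  fixes A :: "complex mat"
  assumes A: "A \<in> carrier_mat n n"
    and inj: "\<And>v. v \<in> carrier_vec n \<Longrightarrow> A *\<^sub>v v = 0\<^sub>v n \<Longrightarrow> v = 0\<^sub>v n"
  obtains B where "B \<in> carrier_mat n n" "A * B = 1\<^sub>m n" "B * A = 1\<^sub>m n"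
proof -
  have "det A \<noteq> 0" using det_0_iff_vec_prod_zero[OF A] inj by blast
  from det_non_zero_imp_unit[OF A this, of "()"] that show thesis
    by (auto simp: Units_def ring_mat_def)
qed

section \<open>The smallest singular value as a lower bound\<close>

text \<open>Cauchy--Schwarz for the form of a positive semidefinite matrix, obtained by evaluating the
  form at \<open>p - K p / C\<close>.\<close>

lemma positive_semidefinite_vnorm_bound:
  assumes K: "K \<in> carrier_mat n n" and herm: "mat_adjoint K = K"
    and psd: "\<And>p. p \<in> carrier_vec n \<Longrightarrow> 0 \<le> Re ((K *\<^sub>v p) \<bullet>c p)"
    and C: "C > 0" and bound: "\<And>p. p \<in> carrier_vec n \<Longrightarrow> vnorm (K *\<^sub>v p) \<le> C * vnorm p"
    and p: "p \<in> carrier_vec n"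
  shows "(vnorm (K *\<^sub>v p))\<^sup>2 \<le> C * Re ((K *\<^sub>v p) \<bullet>c p)"
proof -
  define w where "w = K *\<^sub>v p"
  define c where "c = complex_of_real (- 1 / C)"
  have w: "w \<in> carrier_vec n" and Kw: "K *\<^sub>v w \<in> carrier_vec n" using K p by (auto simp: w_def)
  have cc: "cnj c = c" by (simp add: c_def)
  have Kwp: "(K *\<^sub>v w) \<bullet>c p = w \<bullet>c w"
    using cscalar_prod_mult_mat_vec[OF K w p] by (simp add: herm w_def)
  have "(K *\<^sub>v (p + c \<cdot>\<^sub>v w)) \<bullet>c (p + c \<cdot>\<^sub>v w) = (w + c \<cdot>\<^sub>v (K *\<^sub>v w)) \<bullet>c (p + c \<cdot>\<^sub>v w)"
    using K p w by (simp add: mult_add_distrib_mat_vec[of _ n n] mult_mat_vec[of _ n n] w_def)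
  also have "\<dots> = w \<bullet>c p + 2 * c * (w \<bullet>c w) + c * c * ((K *\<^sub>v w) \<bullet>c w)"
    using p w Kw Kwp
    by (simp add: conjugate_add_vec[of _ n] conjugate_smult_vec cc add_scalar_prod_distrib[of _ n]
        scalar_prod_add_distrib[of _ n] algebra_simps)
  finally have eq: "Re ((K *\<^sub>v (p + c \<cdot>\<^sub>v w)) \<bullet>c (p + c \<cdot>\<^sub>v w))
      = Re (w \<bullet>c p) - 2 / C * (vnorm w)\<^sup>2 + 1 / C\<^sup>2 * Re ((K *\<^sub>v w) \<bullet>c w)"
    by (simp add: cscalar_prod_self c_def power2_eq_square)
  \<comment> \<open>The last term of the expansion is at most half the size of the negative middle
    term, so together they leave at most \<open>- 1 / C * (vnorm w)\<^sup>2\<close>.\<close>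
  have "Re ((K *\<^sub>v w) \<bullet>c w) \<le> vnorm (K *\<^sub>v w) * vnorm w"
    using cmod_cscalar_prod_le[OF Kw w] complex_Re_le_cmod order_trans by blast
  also have "\<dots> \<le> C * (vnorm w)\<^sup>2"
    using mult_right_mono[OF bound[OF w], of "vnorm w"] by (simp add: power2_eq_square)
  finally have "1 / C\<^sup>2 * Re ((K *\<^sub>v w) \<bullet>c w) \<le> 1 / C * (vnorm w)\<^sup>2"
    using C by (simp add: field_simps power2_eq_square)
  with psd[of "p + c \<cdot>\<^sub>v w"] p w have "0 \<le> Re (w \<bullet>c p) - 1 / C * (vnorm w)\<^sup>2"
    unfolding eq by simp
  then show ?thesis using C by (simp add: w_def field_simps)
qed

lemma mult_minus_smult_one_mat_vec:
  fixes H :: "complex mat"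
  assumes "H \<in> carrier_mat n n" "p \<in> carrier_vec n"
  shows "(H - c \<cdot>\<^sub>m 1\<^sub>m n) *\<^sub>v p = H *\<^sub>v p - c \<cdot>\<^sub>v p"
proof -
  have "(c \<cdot>\<^sub>m 1\<^sub>m n) *\<^sub>v p = c \<cdot>\<^sub>v p" using assms by (intro eq_vecI) auto
  then show ?thesis using assms by (simp add: minus_mult_distrib_mat_vec[of _ n n])
qed

text \<open>The infimum \<open>\<mu>\<close> of the Rayleigh quotient is an eigenvalue: along a minimising sequence of unit
  vectors \<open>(H - \<mu>) p\<close> tends to 0, so \<open>H - \<mu>\<close> has no bounded inverse.\<close>

lemma hermitian_least_eigenvalue:
  assumes H: "H \<in> carrier_mat n n" and herm: "mat_adjoint H = H" and n: "0 < n"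
  obtains \<mu> :: real where "eigenvalue H (complex_of_real \<mu>)"
    and "\<And>p. p \<in> carrier_vec n \<Longrightarrow> \<mu> * (vnorm p)\<^sup>2 \<le> Re ((H *\<^sub>v p) \<bullet>c p)"
proof -
  define R where "R = {Re ((H *\<^sub>v p) \<bullet>c p) | p. p \<in> carrier_vec n \<and> vnorm p = 1}"
  define \<mu> where "\<mu> = Inf R"
  define K where "K = H - complex_of_real \<mu> \<cdot>\<^sub>m 1\<^sub>m n"
  have K: "K \<in> carrier_mat n n"
    unfolding K_def by (intro minus_carrier_mat smult_carrier_mat one_carrier_mat)
  have Kmult: "K *\<^sub>v p = H *\<^sub>v p - complex_of_real \<mu> \<cdot>\<^sub>v p" if "p \<in> carrier_vec n" for p
    using H that by (simp add: K_def mult_minus_smult_one_mat_vec)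
  have hermK: "mat_adjoint K = K"
  proof (rule eq_matI)
    fix i j assume ij: "i < dim_row K" "j < dim_col K"
    have "cnj (H $$ (j, i)) = H $$ (i, j)"
      using index_mat_adjoint[of i H j] ij H K herm by simp
    then show "mat_adjoint K $$ (i, j) = K $$ (i, j)"
      using ij H K by (auto simp: K_def)
  qed (use K in auto)
  obtain C0 where C0: "C0 > 0" "\<And>p. p \<in> carrier_vec n \<Longrightarrow> vnorm (H *\<^sub>v p) \<le> C0 * vnorm p"
    using mult_mat_vec_bounded[OF H] by blast
  have bdd: "bdd_below R"
  proof (rule bdd_belowI[of _ "- C0"])
    fix a assume "a \<in> R"
    then obtain p where p: "p \<in> carrier_vec n" "vnorm p = 1" "a = Re ((H *\<^sub>v p) \<bullet>c p)"
      by (auto simp: R_def)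
    then have "\<bar>a\<bar> \<le> vnorm (H *\<^sub>v p) * vnorm p"
      using cmod_cscalar_prod_le[of "H *\<^sub>v p" n p] H abs_Re_le_cmod order_trans by fastforce
    then show "- C0 \<le> a" using C0(2)[OF p(1)] p(2) by simp
  qed
  have ne: "R \<noteq> {}"
    using vnorm_unit_vec[OF n] by (auto simp: R_def intro!: exI[of _ "unit_vec n 0"])
  have low: "\<mu> * (vnorm p)\<^sup>2 \<le> Re ((H *\<^sub>v p) \<bullet>c p)" if p: "p \<in> carrier_vec n" for p
  proof (cases "vnorm p = 0")
    case True
    then have "p = 0\<^sub>v n" using vnorm_eq_0_iff[OF p] by simp
    then show ?thesis using True H by simp
  next
    case False
    then have pos: "vnorm p > 0" using vnorm_nonneg[of p] by linarith
    define c where "c = complex_of_real (1 / vnorm p)"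
    have "vnorm (c \<cdot>\<^sub>v p) = 1" using pos by (simp add: c_def norm_divide)
    then have "Re ((H *\<^sub>v (c \<cdot>\<^sub>v p)) \<bullet>c (c \<cdot>\<^sub>v p)) \<in> R" using p by (auto simp: R_def)
    then have "\<mu> \<le> Re ((H *\<^sub>v (c \<cdot>\<^sub>v p)) \<bullet>c (c \<cdot>\<^sub>v p))"
      unfolding \<mu>_def using bdd by (rule cInf_lower)
    also have "(H *\<^sub>v (c \<cdot>\<^sub>v p)) \<bullet>c (c \<cdot>\<^sub>v p) = c * c * ((H *\<^sub>v p) \<bullet>c p)"
      using H p by (simp add: mult_mat_vec[of _ n n] conjugate_smult_vec c_def)
    also have "Re \<dots> = Re ((H *\<^sub>v p) \<bullet>c p) / (vnorm p)\<^sup>2"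
      by (simp add: c_def power2_eq_square)
    finally show ?thesis using pos by (simp add: field_simps)
  qed
  have form: "Re ((K *\<^sub>v p) \<bullet>c p) = Re ((H *\<^sub>v p) \<bullet>c p) - \<mu> * (vnorm p)\<^sup>2"
    if "p \<in> carrier_vec n" for p
    using that H by (simp add: Kmult minus_scalar_prod_distrib[of _ n] cscalar_prod_self
        del: of_real_power)
  obtain C where C: "C > 0" "\<And>p. p \<in> carrier_vec n \<Longrightarrow> vnorm (K *\<^sub>v p) \<le> C * vnorm p"
    using mult_mat_vec_bounded[OF K] by blast
  have "\<exists>v. v \<in> carrier_vec n \<and> v \<noteq> 0\<^sub>v n \<and> K *\<^sub>v v = 0\<^sub>v n"
  proof (rule ccontr)
    assume "\<not> ?thesis"
    then obtain B where B: "B \<in> carrier_mat n n" "B * K = 1\<^sub>m n"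
      using injective_mat_inverse[OF K] by metis
    obtain D where D: "D > 0" "\<And>p. p \<in> carrier_vec n \<Longrightarrow> vnorm (B *\<^sub>v p) \<le> D * vnorm p"
      using mult_mat_vec_bounded[OF B(1)] by blast
    \<comment> \<open>An inverse bounded by \<open>D\<close> gives
      \<open>vnorm (K *\<^sub>v p) \<ge> 1 / D\<close> on unit vectors, and the semidefinite bound
      turns this into a gap of \<open>1 / (D\<^sup>2 * C)\<close> between \<open>\<mu>\<close> and
      every Rayleigh quotient. This contradicts \<open>\<mu>\<close> being the infimum.\<close>
    have "\<mu> + 1 / (D\<^sup>2 * C) \<le> a" if a: "a \<in> R" for a
    proof -
      obtain p where p: "p \<in> carrier_vec n" "vnorm p = 1" "a = Re ((H *\<^sub>v p) \<bullet>c p)"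
        using a by (auto simp: R_def)
      have "B *\<^sub>v (K *\<^sub>v p) = p"
        using assoc_mult_mat_vec[OF B(1) K p(1)] p(1) by (simp add: B(2))
      with D(2)[of "K *\<^sub>v p"] K p have "1 \<le> D * vnorm (K *\<^sub>v p)" by simp
      then have "1 \<le> (D * vnorm (K *\<^sub>v p))\<^sup>2" by simp
      also have "\<dots> = D\<^sup>2 * (vnorm (K *\<^sub>v p))\<^sup>2" by (simp add: power_mult_distrib)
      also have "\<dots> \<le> D\<^sup>2 * (C * Re ((K *\<^sub>v p) \<bullet>c p))"
        by (intro mult_left_mono positive_semidefinite_vnorm_bound[OF K hermK _ C p(1)])
          (use form low in auto)
      finally have "1 \<le> D\<^sup>2 * C * (a - \<mu>)" using form[OF p(1)] p by (simp add: mult.assoc)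
      then show ?thesis using C(1) D(1) by (simp add: field_simps)
    qed
    then have "\<mu> + 1 / (D\<^sup>2 * C) \<le> \<mu>" unfolding \<mu>_def using ne by (intro cInf_greatest) auto
    then show False using C(1) D(1) by (simp add: field_simps)
  qed
  then obtain v where v: "v \<in> carrier_vec n" "v \<noteq> 0\<^sub>v n" "K *\<^sub>v v = 0\<^sub>v n" by blast
  have "H *\<^sub>v v = complex_of_real \<mu> \<cdot>\<^sub>v v"
  proof (rule eq_vecI)
    fix i assume i: "i < dim_vec (complex_of_real \<mu> \<cdot>\<^sub>v v)"
    have "(K *\<^sub>v v) $ i = (H *\<^sub>v v) $ i - (complex_of_real \<mu> \<cdot>\<^sub>v v) $ i"
      using i v(1) H unfolding Kmult[OF v(1)] by simp
    then show "(H *\<^sub>v v) $ i = (complex_of_real \<mu> \<cdot>\<^sub>v v) $ i" using v i by simp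
  qed (use v H in auto)
  then have "eigenvalue H (complex_of_real \<mu>)"
    using v H unfolding eigenvalue_def eigenvector_def by auto
  then show thesis using low that by blast
qed

lemma mat_adjoint_mult_self_hermitian:
  fixes A :: "complex mat"
  assumes "A \<in> carrier_mat n m"
  shows "mat_adjoint (mat_adjoint A * A) = mat_adjoint A * A"
  using assms by (intro eq_matI) (auto simp: scalar_prod_def mult.commute)

text \<open>Squaring is injective on nonnegative reals and maps the singular values into a finite
  spectrum. Finiteness gives the \<open>Min\<close> in \<open>sigma_min\<close> its meaning as a
  lower bound.\<close>

lemma finite_singular_values:
  assumes "A \<in> carrier_mat n m"
  shows "finite (singular_values A)"
proof (rule inj_on_finite)
  show "inj_on (\<lambda>\<sigma>. complex_of_real (\<sigma>\<^sup>2)) (singular_values A)"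
    by (auto simp: inj_on_def singular_values_def simp del: of_real_power)
  show "(\<lambda>\<sigma>. complex_of_real (\<sigma>\<^sup>2)) ` singular_values A \<subseteq> spectrum (mat_adjoint A * A)"
    by (auto simp: singular_values_def spectrum_def)
  show "finite (spectrum (mat_adjoint A * A))"
    by (rule card_finite_spectrum(1)[of _ m]) (use assms in auto)
qed

text \<open>The form of \<open>mat_adjoint A * A\<close> at \<open>p\<close> is the square of
  \<open>vnorm (A *\<^sub>v p)\<close>, and its least eigenvalue \<open>\<mu>\<close> bounds it from
  below. Since \<open>sqrt \<mu>\<close> is a singular value, \<open>sigma_min A\<close> cannot
  exceed it. Positive dimension guarantees that an eigenvalue exists.\<close>

lemma sigma_min_mult_vnorm_le:
  assumes A: "A \<in> carrier_mat n m" and m: "0 < m" and p: "p \<in> carrier_vec m"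
  shows "sigma_min A * vnorm p \<le> vnorm (A *\<^sub>v p)"
proof -
  let ?H = "mat_adjoint A * A"
  have H: "?H \<in> carrier_mat m m" using A by auto
  obtain \<mu> where ev: "eigenvalue ?H (complex_of_real \<mu>)"
    and low: "\<And>p. p \<in> carrier_vec m \<Longrightarrow> \<mu> * (vnorm p)\<^sup>2 \<le> Re ((?H *\<^sub>v p) \<bullet>c p)"
    using hermitian_least_eigenvalue[OF H mat_adjoint_mult_self_hermitian[OF A] m] by blast
  have form: "(?H *\<^sub>v p) \<bullet>c p = complex_of_real ((vnorm (A *\<^sub>v p))\<^sup>2)"
    if "p \<in> carrier_vec m" for p
  proof -
    have "(?H *\<^sub>v p) \<bullet>c p = (mat_adjoint A *\<^sub>v (A *\<^sub>v p)) \<bullet>c p"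
      using A that by (subst assoc_mult_mat_vec[of _ m n _ m]) auto
    also have "\<dots> = (A *\<^sub>v p) \<bullet>c (A *\<^sub>v p)"
      using A that by (subst cscalar_prod_mult_mat_vec[of _ m n]) auto
    finally show ?thesis by (simp add: cscalar_prod_self)
  qed
  \<comment> \<open>An eigenvector \<open>v\<close> for \<open>\<mu>\<close> satisfies
    \<open>(vnorm (A *\<^sub>v v))\<^sup>2 = \<mu> * (vnorm v)\<^sup>2\<close> with
    \<open>vnorm v > 0\<close>.\<close>
  have "0 \<le> \<mu>"
  proof -
    obtain v where v: "v \<in> carrier_vec m" "v \<noteq> 0\<^sub>v m" "?H *\<^sub>v v = complex_of_real \<mu> \<cdot>\<^sub>v v"
      using ev A unfolding eigenvalue_def eigenvector_def by auto
    have "complex_of_real ((vnorm (A *\<^sub>v v))\<^sup>2) = complex_of_real (\<mu> * (vnorm v)\<^sup>2)"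
      using form[OF v(1)] v by (simp add: cscalar_prod_self)
    then have "(vnorm (A *\<^sub>v v))\<^sup>2 = \<mu> * (vnorm v)\<^sup>2" by (simp only: of_real_eq_iff)
    moreover have "vnorm v > 0"
      using v vnorm_eq_0_iff[OF v(1)] vnorm_nonneg[of v] by linarith
    ultimately show ?thesis
      by (metis zero_le_power2 zero_le_mult_iff zero_less_power not_less)
  qed
  then have "sqrt \<mu> \<in> singular_values A" using ev by (simp add: singular_values_def del: of_real_power)
  then have "sigma_min A \<le> sqrt \<mu>"
    unfolding sigma_min_def using finite_singular_values[OF A] by (intro Min_le)
  then have "sigma_min A * vnorm p \<le> sqrt \<mu> * vnorm p" by (simp add: mult_right_mono)
  also have "\<dots> \<le> vnorm (A *\<^sub>v p)"
  proof (rule power2_le_imp_le)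
    have "\<mu> * (vnorm p)\<^sup>2 \<le> (vnorm (A *\<^sub>v p))\<^sup>2"
      using low[OF p] unfolding form[OF p] by simp
    then show "(sqrt \<mu> * vnorm p)\<^sup>2 \<le> (vnorm (A *\<^sub>v p))\<^sup>2"
      using \<open>0 \<le> \<mu>\<close> by (simp add: power_mult_distrib)
  qed simp
  finally show ?thesis .
qed

section \<open>The Riccati equation\<close>

text \<open>Banach's fixed-point theorem on a closed ball around 0, which contains the starting
  point 0. Convergence of the iterates is obtained coordinate by coordinate, which suffices in
  finite dimension.\<close>

lemma vec_contraction_fixpoint:
  fixes \<Phi> :: "complex vec \<Rightarrow> complex vec"
  assumes \<rho>: "0 \<le> \<rho>" and c: "0 \<le> c" "c < 1"
    and self: "\<And>p. p \<in> carrier_vec n \<Longrightarrow> vnorm p \<le> \<rho> \<Longrightarrow> \<Phi> p \<in> carrier_vec n \<and> vnorm (\<Phi> p) \<le> \<rho>"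
    and contr: "\<And>p q. \<lbrakk>p \<in> carrier_vec n; vnorm p \<le> \<rho>; q \<in> carrier_vec n; vnorm q \<le> \<rho>\<rbrakk>
      \<Longrightarrow> vnorm (\<Phi> p - \<Phi> q) \<le> c * vnorm (p - q)"
  obtains p where "p \<in> carrier_vec n" "vnorm p \<le> \<rho>" "\<Phi> p = p"
proof -
  define P where "P j = (\<Phi> ^^ j) (0\<^sub>v n)" for j
  have P0: "P 0 = 0\<^sub>v n" and PSuc: "P (Suc j) = \<Phi> (P j)" for j by (simp_all add: P_def)
  have P: "P j \<in> carrier_vec n \<and> vnorm (P j) \<le> \<rho>" for j
    by (induction j) (use \<rho> self in \<open>auto simp: P0 PSuc\<close>)
  then have dimP: "dim_vec (P j) = n" for j by auto
  have step: "vnorm (P (Suc j) - P j) \<le> c ^ j * \<rho>" for j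
  proof (induction j)
    case 0
    have "P (Suc 0) - P 0 = P (Suc 0)" using P[of "Suc 0"] by (auto simp: P0)
    then show ?case using P[of "Suc 0"] by simp
  next
    case (Suc j)
    have "vnorm (P (Suc (Suc j)) - P (Suc j)) \<le> c * vnorm (P (Suc j) - P j)"
      using contr[of "P (Suc j)" "P j"] P[of j] P[of "Suc j"] unfolding PSuc by simp
    also have "\<dots> \<le> c * (c ^ j * \<rho>)" using Suc c(1) by (rule mult_left_mono)
    finally show ?case by simp
  qed
  have "\<exists>l. (\<lambda>j. P j $ i) \<longlonglongrightarrow> l" if i: "i < n" for i
  proof -
    \<comment> \<open>The increments are dominated by a geometric series; telescoping turns
      summability into convergence of the coordinates.\<close>
    have "summable (\<lambda>j. P (Suc j) $ i - P j $ i)"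
    proof (rule summable_comparison_test')
      show "summable (\<lambda>j. c ^ j * \<rho>)" using c by (intro summable_mult2 summable_geometric) auto
      fix j
      show "norm (P (Suc j) $ i - P j $ i) \<le> c ^ j * \<rho>"
        using cmod_index_le_vnorm[of i "P (Suc j) - P j"] step[of j] i dimP by simp
    qed
    then have "convergent (\<lambda>j. P j $ i - P 0 $ i)"
      by (simp add: summable_iff_convergent sum_lessThan_telescope[of "\<lambda>j. P j $ i"])
    then show ?thesis using i by (simp add: P0 convergent_def)
  qed
  then obtain l where l: "\<And>i. i < n \<Longrightarrow> (\<lambda>j. P j $ i) \<longlonglongrightarrow> l i" by metis
  define p where "p = vec n l"
  have p: "p \<in> carrier_vec n" by (simp add: p_def)
  have "(\<lambda>j. vnorm (P j)) \<longlonglongrightarrow> vnorm p"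
    unfolding vnorm_def dimP p_def dim_vec
    by (intro tendsto_intros) (use l in auto)
  then have p_le: "vnorm p \<le> \<rho>" by (rule LIMSEQ_le_const2) (use P in auto)
  have "vnorm (P j - p) = sqrt (\<Sum>i<n. (cmod (P j $ i - l i))\<^sup>2)" for j
    by (simp add: vnorm_def p_def)
  moreover have "(\<lambda>j. sqrt (\<Sum>i<n. (cmod (P j $ i - l i))\<^sup>2))
      \<longlonglongrightarrow> sqrt (\<Sum>i<n. (cmod (l i - l i))\<^sup>2)"
    by (intro tendsto_intros) (use l in auto)
  ultimately have "(\<lambda>j. vnorm (P j - p)) \<longlonglongrightarrow> 0" by simp
  then have lim0: "(\<lambda>j. c * vnorm (P j - p)) \<longlonglongrightarrow> 0"
    by (rule tendsto_mult_right_zero)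
  \<comment> \<open>Towards the fixed point: the shifted iterates tend to \<open>\<Phi> p\<close> by
    the contraction property and to \<open>p\<close> as a shifted convergent sequence.\<close>
  have dim\<Phi>: "dim_vec (\<Phi> p) = n" using self[OF p p_le] by auto
  have "\<Phi> p = p"
  proof (rule eq_vecI)
    fix i assume "i < dim_vec p"
    then have i: "i < n" using p by simp
    have "(\<lambda>j. P (Suc j) $ i - \<Phi> p $ i) \<longlonglongrightarrow> 0"
    proof (rule Lim_null_comparison[OF _ lim0], intro always_eventually allI)
      fix j
      have "cmod (P (Suc j) $ i - \<Phi> p $ i) \<le> vnorm (P (Suc j) - \<Phi> p)"
        using cmod_index_le_vnorm[of i "P (Suc j) - \<Phi> p"] by (simp add: i dim\<Phi> dimP)
      also have "\<dots> \<le> c * vnorm (P j - p)" unfolding PSuc using P p p_le by (intro contr) auto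
      finally show "cmod (P (Suc j) $ i - \<Phi> p $ i) \<le> c * vnorm (P j - p)" .
    qed
    then have "(\<lambda>j. P (Suc j) $ i) \<longlonglongrightarrow> \<Phi> p $ i" by (simp add: LIM_zero_iff)
    moreover have "(\<lambda>j. P (Suc j) $ i) \<longlonglongrightarrow> l i" using l[OF i] by (rule LIMSEQ_Suc)
    ultimately show "\<Phi> p $ i = p $ i" using i LIMSEQ_unique by (auto simp: p_def)
  qed (use p dim\<Phi> in auto)
  then show thesis using p p_le that by blast
qed

text \<open>The radius \<open>\<rho>\<close> of the invariant ball is the smaller root of \<open>\<eta> \<rho>\<^sup>2 - \<delta> \<rho> + \<epsilon> = 0\<close>, on which
  the iteration contracts with factor \<open>2 \<eta> \<rho> / \<delta>\<close>.\<close>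

lemma riccati_solution:
  assumes L: "L \<in> carrier_mat n n" and \<delta>: "0 < \<delta>"
    and low: "\<And>p. p \<in> carrier_vec n \<Longrightarrow> \<delta> * vnorm p \<le> vnorm (L *\<^sub>v p)"
    and g: "g \<in> carrier_vec n" "vnorm g \<le> \<epsilon>"
    and h: "h \<in> carrier_vec n" "vnorm h \<le> \<eta>"
    and small: "4 * \<epsilon> * \<eta> < \<delta>\<^sup>2"
  obtains p where "p \<in> carrier_vec n" "L *\<^sub>v p = (p \<bullet>c h) \<cdot>\<^sub>v p - g"
    "vnorm p < 2 * \<epsilon> / \<delta> \<or> (\<epsilon> = 0 \<and> vnorm p = 0)"
proof (cases "\<epsilon> = 0")
  \<comment> \<open>The bound \<open>2 * \<epsilon> / \<delta>\<close> is 0 here, so no norm lies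
    strictly below it; \<open>g\<close> vanishes and the solution \<open>p = 0\<close> meets the
    second alternative instead.\<close>
  case True
  then have "g = 0\<^sub>v n" using g vnorm_eq_0_iff[OF g(1)] vnorm_nonneg[of g] by linarith
  then have "L *\<^sub>v 0\<^sub>v n = (0\<^sub>v n \<bullet>c h) \<cdot>\<^sub>v 0\<^sub>v n - g"
    using L h by (intro eq_vecI) auto
  then show thesis using that[of "0\<^sub>v n"] True by simp
next
  case False
  then have \<epsilon>: "0 < \<epsilon>" using g(2) vnorm_nonneg[of g] by linarith
  have \<eta>: "0 \<le> \<eta>" using h(2) vnorm_nonneg[of h] by linarith
  \<comment> \<open>\<open>d\<close> is the square root of the discriminant. Writing the smaller
    root as \<open>2 * \<epsilon> / (\<delta> + d)\<close> avoids dividing by \<open>\<eta>\<close>,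
    which may be 0, and makes the bound \<open>\<rho> < 2 * \<epsilon> / \<delta>\<close> immediate
    from \<open>d > 0\<close>.\<close>
  define d where "d = sqrt (\<delta>\<^sup>2 - 4 * \<epsilon> * \<eta>)"
  define \<rho> where "\<rho> = 2 * \<epsilon> / (\<delta> + d)"
  have d: "0 < d" "d\<^sup>2 = \<delta>\<^sup>2 - 4 * \<epsilon> * \<eta>" using small by (auto simp: d_def)
  have \<rho>: "0 < \<rho>" using \<epsilon> \<delta> d by (simp add: \<rho>_def)
  have \<rho>_lt: "\<rho> < 2 * \<epsilon> / \<delta>" using \<epsilon> \<delta> d by (simp add: \<rho>_def frac_less2)
  have eq1: "2 * \<eta> * \<rho> = \<delta> - d"
  proof -
    have "2 * \<eta> * \<rho> = (\<delta>\<^sup>2 - d\<^sup>2) / (\<delta> + d)" by (simp add: \<rho>_def d(2))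
    also have "\<dots> = \<delta> - d" using \<delta> d(1) by (simp add: field_simps power2_eq_square)
    finally show ?thesis .
  qed
  have eq2: "\<eta> * \<rho> * \<rho> + \<epsilon> = \<delta> * \<rho>"
  proof -
    have "(\<delta> + d) * \<rho> = 2 * \<epsilon>" using \<delta> d(1) by (simp add: \<rho>_def)
    then have "2 * (\<delta> * \<rho>) = 2 * \<epsilon> + (\<delta> - d) * \<rho>" by (simp add: algebra_simps)
    then show ?thesis unfolding eq1[symmetric] by simp
  qed
  \<comment> \<open>The lower bound \<open>low\<close> makes \<open>L\<close> injective; its inverse
    \<open>B\<close> then has norm at most \<open>1 / \<delta>\<close>, and solutions are the fixed
    points of \<open>\<Phi>\<close>.\<close>
  have "v = 0\<^sub>v n" if "v \<in> carrier_vec n" "L *\<^sub>v v = 0\<^sub>v n" for v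
  proof -
    have "\<delta> * vnorm v \<le> 0" using low[OF that(1)] that(2) by simp
    then show ?thesis using \<delta> vnorm_nonneg[of v] vnorm_eq_0_iff[OF that(1)]
      by (simp add: mult_le_0_iff)
  qed
  then obtain B where B: "B \<in> carrier_mat n n" "L * B = 1\<^sub>m n"
    using injective_mat_inverse[OF L] by metis
  have LB: "L *\<^sub>v (B *\<^sub>v w) = w" if "w \<in> carrier_vec n" for w
    using assoc_mult_mat_vec[OF L B(1) that] that by (simp add: B(2))
  have Bw: "vnorm (B *\<^sub>v w) \<le> vnorm w / \<delta>" if "w \<in> carrier_vec n" for w
    using low[of "B *\<^sub>v w"] B that \<delta> by (simp add: LB field_simps)
  have sp: "cmod (p \<bullet>c h) \<le> \<eta> * vnorm p" if "p \<in> carrier_vec n" for p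
    using cmod_cscalar_prod_le[OF that h(1)] mult_right_mono[OF h(2), of "vnorm p"]
    by (simp add: mult.commute)
  define \<Phi> where "\<Phi> p = B *\<^sub>v ((p \<bullet>c h) \<cdot>\<^sub>v p - g)" for p
  obtain p where p: "p \<in> carrier_vec n" "vnorm p \<le> \<rho>" "\<Phi> p = p"
  proof (rule vec_contraction_fixpoint[of \<rho> "2 * \<eta> * \<rho> / \<delta>" n \<Phi>])
    show "0 \<le> \<rho>" "0 \<le> 2 * \<eta> * \<rho> / \<delta>" using \<rho> \<eta> \<delta> by auto
    show "2 * \<eta> * \<rho> / \<delta> < 1" unfolding eq1 using \<delta> d by simp
  next
    fix p assume p: "p \<in> carrier_vec n" "vnorm p \<le> \<rho>"
    have "vnorm ((p \<bullet>c h) \<cdot>\<^sub>v p - g) \<le> cmod (p \<bullet>c h) * vnorm p + vnorm g"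
      using vnorm_triangle[of "(p \<bullet>c h) \<cdot>\<^sub>v p" n "- g"] p g
      by (simp add: minus_add_uminus_vec[of _ n])
    also have "\<dots> \<le> \<eta> * \<rho> * \<rho> + \<epsilon>"
    proof (intro add_mono mult_mono g(2) p(2))
      show "cmod (p \<bullet>c h) \<le> \<eta> * \<rho>"
        using sp[OF p(1)] mult_left_mono[OF p(2) \<eta>] by linarith
    qed (use \<eta> \<rho> in auto)
    also have "\<dots> = \<delta> * \<rho>" by (rule eq2)
    finally have "vnorm ((p \<bullet>c h) \<cdot>\<^sub>v p - g) / \<delta> \<le> \<rho>" using \<delta> by (simp add: field_simps)
    moreover have "(p \<bullet>c h) \<cdot>\<^sub>v p - g \<in> carrier_vec n" using p g by auto
    ultimately show "\<Phi> p \<in> carrier_vec n \<and> vnorm (\<Phi> p) \<le> \<rho>"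
      using Bw B unfolding \<Phi>_def by (meson mult_mat_vec_carrier order_trans)
  next
    fix p q assume p: "p \<in> carrier_vec n" "vnorm p \<le> \<rho>" and q: "q \<in> carrier_vec n" "vnorm q \<le> \<rho>"
    have pq: "p - q \<in> carrier_vec n" using p q by auto
    have c1: "(p \<bullet>c h) \<cdot>\<^sub>v p - g \<in> carrier_vec n" "(q \<bullet>c h) \<cdot>\<^sub>v q - g \<in> carrier_vec n"
      using p q g by auto
    have "\<Phi> p - \<Phi> q = B *\<^sub>v (((p \<bullet>c h) \<cdot>\<^sub>v p - g) - ((q \<bullet>c h) \<cdot>\<^sub>v q - g))"
      unfolding \<Phi>_def using mult_minus_distrib_mat_vec[OF B(1) c1] by simp
    \<comment> \<open>The constant \<open>g\<close> cancels and the quadratic difference splits into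
      two products, each linear in \<open>p - q\<close> and of norm at most
      \<open>\<eta> * \<rho> * vnorm (p - q)\<close>. This is where the factor 2 of the contraction
      constant comes from.\<close>
    also have "((p \<bullet>c h) \<cdot>\<^sub>v p - g) - ((q \<bullet>c h) \<cdot>\<^sub>v q - g)
        = (p \<bullet>c h) \<cdot>\<^sub>v (p - q) + ((p - q) \<bullet>c h) \<cdot>\<^sub>v q"
      using p q g h
      by (intro eq_vecI) (auto simp: minus_scalar_prod_distrib[of _ n] algebra_simps)
    finally have "vnorm (\<Phi> p - \<Phi> q) \<le> vnorm ((p \<bullet>c h) \<cdot>\<^sub>v (p - q) + ((p - q) \<bullet>c h) \<cdot>\<^sub>v q) / \<delta>"
      using Bw p q pq by simp
    also have "\<dots> \<le> (2 * \<eta> * \<rho> * vnorm (p - q)) / \<delta>"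
    proof (rule divide_right_mono)
      have "vnorm ((p \<bullet>c h) \<cdot>\<^sub>v (p - q) + ((p - q) \<bullet>c h) \<cdot>\<^sub>v q)
          \<le> cmod (p \<bullet>c h) * vnorm (p - q) + cmod ((p - q) \<bullet>c h) * vnorm q"
        using vnorm_triangle[of "(p \<bullet>c h) \<cdot>\<^sub>v (p - q)" n "((p - q) \<bullet>c h) \<cdot>\<^sub>v q"] q pq by simp
      also have "\<dots> \<le> \<eta> * \<rho> * vnorm (p - q) + \<eta> * vnorm (p - q) * \<rho>"
      proof (intro add_mono mult_mono q(2) sp[OF pq])
        show "cmod (p \<bullet>c h) \<le> \<eta> * \<rho>"
          using sp[OF p(1)] mult_left_mono[OF p(2) \<eta>] by linarith
      qed (use \<eta> \<rho> in auto)
      finally show "vnorm ((p \<bullet>c h) \<cdot>\<^sub>v (p - q) + ((p - q) \<bullet>c h) \<cdot>\<^sub>v q)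
          \<le> 2 * \<eta> * \<rho> * vnorm (p - q)" by (simp add: algebra_simps)
    qed (use \<delta> in simp)
    finally show "vnorm (\<Phi> p - \<Phi> q) \<le> 2 * \<eta> * \<rho> / \<delta> * vnorm (p - q)" by simp
  qed
  have "L *\<^sub>v p = L *\<^sub>v \<Phi> p" using p(3) by simp
  also have "\<dots> = (p \<bullet>c h) \<cdot>\<^sub>v p - g" unfolding \<Phi>_def using p g by (intro LB) auto
  finally show thesis using that p \<rho>_lt by fastforce
qed

section \<open>From the Riccati solution to an eigenvector, in a unitary basis\<close>

lemma index_mat_adjoint_mult_self:
  fixes A :: "complex mat"
  assumes "i < dim_col A" "j < dim_col A"
  shows "(mat_adjoint A * A) $$ (i, j) = col A j \<bullet>c col A i"
  using assms by (simp add: scalar_prod_def mult.commute)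

text \<open>The contraction bound follows from the isometry: for
  \<open>u = mat_adjoint Y *\<^sub>v w\<close>, the square of \<open>vnorm u\<close> is the product
  of \<open>Y *\<^sub>v u\<close> with \<open>w\<close>, hence at most
  \<open>vnorm u * vnorm w\<close>.\<close>

lemma orthonormal_cols_vnorm:
  assumes Y: "Y \<in> carrier_mat n m" and YY: "mat_adjoint Y * Y = 1\<^sub>m m"
  shows "p \<in> carrier_vec m \<Longrightarrow> vnorm (Y *\<^sub>v p) = vnorm p"
    and "w \<in> carrier_vec n \<Longrightarrow> vnorm (mat_adjoint Y *\<^sub>v w) \<le> vnorm w"
proof -
  have iso: "vnorm (Y *\<^sub>v p) = vnorm p" if p: "p \<in> carrier_vec m" for p
  proof -
    have "mat_adjoint Y *\<^sub>v (Y *\<^sub>v p) = p"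
      using assoc_mult_mat_vec[of "mat_adjoint Y" m n Y m p] Y p by (simp add: YY)
    then have "(Y *\<^sub>v p) \<bullet>c (Y *\<^sub>v p) = p \<bullet>c p"
      using cscalar_prod_mult_mat_vec[OF Y p, of "Y *\<^sub>v p"] Y p by simp
    then have "(vnorm (Y *\<^sub>v p))\<^sup>2 = (vnorm p)\<^sup>2"
      unfolding cscalar_prod_self of_real_eq_iff .
    then show ?thesis by simp
  qed
  then show "p \<in> carrier_vec m \<Longrightarrow> vnorm (Y *\<^sub>v p) = vnorm p" .
  assume w: "w \<in> carrier_vec n"
  define u where "u = mat_adjoint Y *\<^sub>v w"
  have u: "u \<in> carrier_vec m" using Y w by (simp add: u_def mult_mat_vec_carrier[of _ m n])
  have "complex_of_real ((vnorm u)\<^sup>2) = (Y *\<^sub>v u) \<bullet>c w"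
    using cscalar_prod_mult_mat_vec[OF Y u w] by (simp add: u_def cscalar_prod_self)
  then have "(vnorm u)\<^sup>2 = cmod ((Y *\<^sub>v u) \<bullet>c w)" by (metis abs_of_nonneg norm_of_real zero_le_power2)
  also have "\<dots> \<le> vnorm u * vnorm w"
    using cmod_cscalar_prod_le[of "Y *\<^sub>v u" n w] Y u w iso[OF u] by simp
  finally have "vnorm u * vnorm u \<le> vnorm u * vnorm w" by (simp add: power2_eq_square)
  then show "vnorm (mat_adjoint Y *\<^sub>v w) \<le> vnorm w"
    unfolding u_def[symmetric] using vnorm_nonneg[of u] vnorm_nonneg[of w]
    by (cases "vnorm u = 0") (auto simp: mult_le_cancel_left)
qed

text \<open>Orthogonality of the residual to \<open>q\<close> says that \<open>\<theta>\<close> is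
  the Rayleigh quotient of \<open>q\<close>. The Riccati equation removes the component of the new
  residual along \<open>Y\<close>, and the shift of the eigenvalue removes the one along
  \<open>q\<close>. The left residual enters through \<open>s_eq\<close>, that is, through its
  action on vectors.\<close>

lemma perturbed_eigenvector:
  assumes B: "B \<in> carrier_mat N N" and q: "q \<in> carrier_vec N" and Y: "Y \<in> carrier_mat N r"
    and unit: "unitary_mat (mat_of_cols N (q # cols Y))"
    and s: "s \<in> carrier_vec N"
    and s_eq: "\<And>z. z \<in> carrier_vec N \<Longrightarrow> z \<bullet>c s = (B *\<^sub>v z) \<bullet>c q - \<theta> * (z \<bullet>c q)"
    and res: "(B *\<^sub>v q - \<theta> \<cdot>\<^sub>v q) \<bullet>c q = 0" "vnorm (B *\<^sub>v q - \<theta> \<cdot>\<^sub>v q) \<le> \<epsilon>"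
    and \<delta>: "0 < \<delta>"
    and low: "\<And>p. p \<in> carrier_vec r \<Longrightarrow>
      \<delta> * vnorm p \<le> vnorm ((mat_adjoint Y * B * Y - \<theta> \<cdot>\<^sub>m 1\<^sub>m r) *\<^sub>v p)"
    and small: "4 * \<epsilon> * vnorm s < \<delta>\<^sup>2"
  obtains p where "p \<in> carrier_vec r" "vnorm (Y *\<^sub>v p) = vnorm p" "(Y *\<^sub>v p) \<bullet>c q = 0"
    "B *\<^sub>v (q + Y *\<^sub>v p) = (\<theta> + (Y *\<^sub>v p) \<bullet>c s) \<cdot>\<^sub>v (q + Y *\<^sub>v p)"
    "vnorm p < 2 * \<epsilon> / \<delta> \<or> (\<epsilon> = 0 \<and> vnorm p = 0)"
proof -
  define Q where "Q = mat_of_cols N (q # cols Y)"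
  have colQ: "col Q 0 = q" "\<And>j. j < r \<Longrightarrow> col Q (Suc j) = col Y j"
    using q Y by (auto simp: Q_def cols_def)
  have Qdim: "dim_row Q = N" "dim_col Q = Suc r" using Y by (auto simp: Q_def)
  \<comment> \<open>A unitary matrix is square, which fixes the number of columns of
    \<open>Y\<close>.\<close>
  have Nr: "N = Suc r" using unit Qdim unfolding unitary_mat_def Q_def[symmetric] by simp
  have Q: "Q \<in> carrier_mat N N" using Qdim Nr by auto
  have QQ: "mat_adjoint Q * Q = 1\<^sub>m N" "Q * mat_adjoint Q = 1\<^sub>m N"
    using unit Qdim Nr unfolding unitary_mat_def Q_def[symmetric] by auto
  have orth: "col Q j \<bullet>c col Q i = (if i = j then 1 else 0)" if "i < N" "j < N" for i j
    using index_mat_adjoint_mult_self[of i Q j] that Qdim Nr by (simp add: QQ)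
  let ?Y' = "mat_adjoint Y"
  have Y': "?Y' \<in> carrier_mat r N" using Y by simp
  have qq: "q \<bullet>c q = 1" using orth[of 0 0] Nr colQ by simp
  have YY: "?Y' * Y = 1\<^sub>m r"
  proof (rule eq_matI)
    fix i j assume "i < dim_row (1\<^sub>m r)" "j < dim_col (1\<^sub>m r)"
    then show "(?Y' * Y) $$ (i, j) = 1\<^sub>m r $$ (i, j)"
      using index_mat_adjoint_mult_self[of i Y j] orth[of "Suc i" "Suc j"] Y Nr colQ by simp
  qed (use Y in auto)
  have Yq: "?Y' *\<^sub>v q = 0\<^sub>v r"
  proof (rule eq_vecI)
    fix j assume "j < dim_vec (0\<^sub>v r)"
    then show "(?Y' *\<^sub>v q) $ j = 0\<^sub>v r $ j"
      using index_mat_adjoint_mult_vec[OF Y q, of j] orth[of "Suc j" 0] Nr colQ by simp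
  qed (use Y in auto)
  \<comment> \<open>The columns of the unitary \<open>Q\<close> form a basis, so a vector orthogonal
    to \<open>q\<close> and to all columns of \<open>Y\<close> is 0.\<close>
  have kernel: "w = 0\<^sub>v N" if w: "w \<in> carrier_vec N" "w \<bullet>c q = 0" "?Y' *\<^sub>v w = 0\<^sub>v r" for w
  proof -
    have "mat_adjoint Q *\<^sub>v w = 0\<^sub>v N"
    proof (rule eq_vecI)
      fix j assume j: "j < dim_vec (0\<^sub>v N)"
      show "(mat_adjoint Q *\<^sub>v w) $ j = 0\<^sub>v N $ j"
      proof (cases j)
        case 0
        then show ?thesis using index_mat_adjoint_mult_vec[OF Q w(1), of j] j colQ w by simp
      next
        case (Suc i)
        then show ?thesis
          using index_mat_adjoint_mult_vec[OF Q w(1), of j] j colQ w Nr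
            index_mat_adjoint_mult_vec[OF Y w(1), of i] by simp
      qed
    qed (use Q in auto)
    moreover have "w = Q *\<^sub>v (mat_adjoint Q *\<^sub>v w)"
      using assoc_mult_mat_vec[of Q N N "mat_adjoint Q" N w] Q w by (simp add: QQ)
    ultimately show ?thesis using Q by (auto intro!: eq_vecI)
  qed
  define u where "u = B *\<^sub>v q - \<theta> \<cdot>\<^sub>v q"
  define L where "L = ?Y' * B * Y - \<theta> \<cdot>\<^sub>m 1\<^sub>m r"
  have u: "u \<in> carrier_vec N" using B q by (auto simp: u_def)
  have M: "?Y' * B * Y \<in> carrier_mat r r" using Y Y' B by auto
  have L: "L \<in> carrier_mat r r"
    unfolding L_def by (intro minus_carrier_mat smult_carrier_mat one_carrier_mat)
  have g: "?Y' *\<^sub>v u \<in> carrier_vec r" "vnorm (?Y' *\<^sub>v u) \<le> \<epsilon>"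
    using Y' u orthonormal_cols_vnorm(2)[OF Y YY u] res(2) unfolding u_def[symmetric]
    by (auto intro: order_trans)
  have h: "?Y' *\<^sub>v s \<in> carrier_vec r" "vnorm (?Y' *\<^sub>v s) \<le> vnorm s"
    using Y' s orthonormal_cols_vnorm(2)[OF Y YY s] by auto
  obtain p where p: "p \<in> carrier_vec r"
    and Lp: "L *\<^sub>v p = (p \<bullet>c (?Y' *\<^sub>v s)) \<cdot>\<^sub>v p - ?Y' *\<^sub>v u"
    and bound: "vnorm p < 2 * \<epsilon> / \<delta> \<or> (\<epsilon> = 0 \<and> vnorm p = 0)"
    using riccati_solution[OF L \<delta> low[folded L_def] g h small] by blast
  define z where "z = Y *\<^sub>v p"
  define \<nu> where "\<nu> = z \<bullet>c s"
  have z: "z \<in> carrier_vec N" using Y p by (simp add: z_def)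
  have \<nu>: "p \<bullet>c (?Y' *\<^sub>v s) = \<nu>"
    using cscalar_prod_mult_mat_vec[OF Y p s] by (simp add: \<nu>_def z_def)
  have zq: "z \<bullet>c q = 0" unfolding z_def using cscalar_prod_mult_mat_vec[OF Y p q] p by (simp add: Yq)
  have Yz: "?Y' *\<^sub>v z = p"
    using assoc_mult_mat_vec[OF Y' Y p] p by (simp add: YY z_def)
  \<comment> \<open>The Riccati equation read as the projection of \<open>B *\<^sub>v z\<close> onto
    the columns of \<open>Y\<close>.\<close>
  have YBz: "?Y' *\<^sub>v (B *\<^sub>v z) = \<theta> \<cdot>\<^sub>v p + (\<nu> \<cdot>\<^sub>v p - ?Y' *\<^sub>v u)"
  proof -
    have "?Y' *\<^sub>v (B *\<^sub>v z) = (?Y' * B * Y) *\<^sub>v p"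
      using assoc_mult_mat_vec[OF mult_carrier_mat[OF Y' B] Y p] assoc_mult_mat_vec[OF Y' B z]
      by (simp add: z_def)
    moreover have "(?Y' * B * Y) *\<^sub>v p - \<theta> \<cdot>\<^sub>v p = \<nu> \<cdot>\<^sub>v p - ?Y' *\<^sub>v u"
      using Lp unfolding L_def mult_minus_smult_one_mat_vec[OF M p] \<nu> .
    ultimately have "?Y' *\<^sub>v (B *\<^sub>v z) - \<theta> \<cdot>\<^sub>v p = \<nu> \<cdot>\<^sub>v p - ?Y' *\<^sub>v u" by simp
    moreover have "?Y' *\<^sub>v (B *\<^sub>v z) = \<theta> \<cdot>\<^sub>v p + (?Y' *\<^sub>v (B *\<^sub>v z) - \<theta> \<cdot>\<^sub>v p)"
      using Y' p by (intro eq_vecI) auto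
    ultimately show ?thesis by simp
  qed
  \<comment> \<open>This is the residual of \<open>q + z\<close> for the eigenvalue
    \<open>\<theta> + \<nu>\<close>, expanded so that both projections can be computed
    termwise.\<close>
  define w where "w = (u + B *\<^sub>v z) - (\<nu> \<cdot>\<^sub>v q + (\<theta> + \<nu>) \<cdot>\<^sub>v z)"
  have w: "w \<in> carrier_vec N" using u z q B by (auto simp: w_def)
  have Bz: "B *\<^sub>v z \<in> carrier_vec N" using B z by simp
  \<comment> \<open>As \<open>u\<close> and \<open>z\<close> are orthogonal to \<open>q\<close>,
    what remains is \<open>(B *\<^sub>v z) \<bullet>c q - \<nu>\<close>, and \<open>s_eq\<close>
    identifies the first term with \<open>\<nu>\<close>.\<close>
  have "w \<bullet>c q = 0"
    using u z q Bz res(1)[folded u_def] s_eq[OF z, folded \<nu>_def] zq qq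
    by (simp add: w_def minus_scalar_prod_distrib[of _ N] add_scalar_prod_distrib[of _ N])
  moreover have "?Y' *\<^sub>v w = 0\<^sub>v r"
  proof -
    have "?Y' *\<^sub>v w = (?Y' *\<^sub>v u + ?Y' *\<^sub>v (B *\<^sub>v z))
        - (\<nu> \<cdot>\<^sub>v (?Y' *\<^sub>v q) + (\<theta> + \<nu>) \<cdot>\<^sub>v (?Y' *\<^sub>v z))"
      using Y' u z q Bz
      by (simp add: w_def mult_minus_distrib_mat_vec[of _ r N] mult_add_distrib_mat_vec[of _ r N]
          mult_mat_vec[of _ r N])
    also have "\<dots> = 0\<^sub>v r"
      unfolding YBz Yz Yq using p g(1) Y by (intro eq_vecI) (auto simp: algebra_simps)
    finally show ?thesis .
  qed
  ultimately have w0: "w = 0\<^sub>v N" using kernel w by blast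
  have "B *\<^sub>v (q + z) = (\<theta> + \<nu>) \<cdot>\<^sub>v (q + z)"
  proof (rule eq_vecI)
    fix i assume i: "i < dim_vec ((\<theta> + \<nu>) \<cdot>\<^sub>v (q + z))"
    have i': "i < N" using i z by simp
    have "w $ i = 0" using w0 i' by simp
    then have "(B *\<^sub>v q) $ i - \<theta> * q $ i + (B *\<^sub>v z) $ i = \<nu> * q $ i + (\<theta> + \<nu>) * z $ i"
      using i' B q z unfolding w_def u_def by (simp del: index_mult_mat_vec)
    moreover have "(B *\<^sub>v (q + z)) $ i = (B *\<^sub>v q) $ i + (B *\<^sub>v z) $ i"
      unfolding mult_add_distrib_mat_vec[OF B q z] using i' B by (simp del: index_mult_mat_vec)
    ultimately show "(B *\<^sub>v (q + z)) $ i = ((\<theta> + \<nu>) \<cdot>\<^sub>v (q + z)) $ i"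
      using i' q z by (simp add: algebra_simps del: index_mult_mat_vec)
  qed (use B z in auto)
  then show thesis
    using that[of p] p bound zq orthonormal_cols_vnorm(1)[OF Y YY p] by (simp add: z_def \<nu>_def)
qed

section \<open>The block matrices of the bidiagonalization\<close>

lemma append_vec_assoc: "u @\<^sub>v v @\<^sub>v w = (u @\<^sub>v v) @\<^sub>v w"
  by (intro eq_vecI) auto

lemma smult_append_vec: "c \<cdot>\<^sub>v (u @\<^sub>v v) = (c \<cdot>\<^sub>v u) @\<^sub>v (c \<cdot>\<^sub>v v)"
  by (intro eq_vecI) auto

text \<open>Zero padding leaves only the first \<open>k\<close> columns of \<open>A\<close>. The
  lower part of the product is kept as a sum so that the triangular and the Hessenberg case can each
  evaluate it.\<close>

lemma mult_mat_vec_pad_zero: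
  assumes "A \<in> carrier_mat m m" "k \<le> m" "x \<in> carrier_vec k"
  shows "A *\<^sub>v (x @\<^sub>v 0\<^sub>v (m - k))
    = (leading_submat k A *\<^sub>v x) @\<^sub>v vec (m - k) (\<lambda>i. \<Sum>j<k. A $$ (k + i, j) * x $ j)"
    (is "?l = ?r")
proof (rule eq_vecI)
  fix i assume "i < dim_vec ?r"
  then have i: "i < m" using assms by (simp add: leading_submat_def)
  have "?l $ i = (\<Sum>j<m. if j < k then A $$ (i, j) * x $ j else 0)"
    using assms i by (auto simp: scalar_prod_def atLeast0LessThan intro!: sum.cong)
  also have "\<dots> = (\<Sum>j<k. A $$ (i, j) * x $ j)"
    using assms(2) by (intro sum.mono_neutral_cong_right) auto
  also have "\<dots> = ?r $ i"
    using assms i by (auto simp: leading_submat_def scalar_prod_def atLeast0LessThan intro!: sum.cong)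
  finally show "?l $ i = ?r $ i" .
qed (use assms in \<open>auto simp: leading_submat_def\<close>)

lemma upper_triangular_mult_pad_zero:
  assumes A: "A \<in> carrier_mat m m" "upper_triangular A" and "k \<le> m" "x \<in> carrier_vec k"
  shows "A *\<^sub>v (x @\<^sub>v 0\<^sub>v (m - k)) = (leading_submat k A *\<^sub>v x) @\<^sub>v 0\<^sub>v (m - k)"
proof -
  have "vec (m - k) (\<lambda>i. \<Sum>j<k. A $$ (k + i, j) * x $ j) = 0\<^sub>v (m - k)"
    using A by (intro eq_vecI) (auto intro!: sum.neutral simp: upper_triangular_def)
  then show ?thesis using assms by (simp add: mult_mat_vec_pad_zero)
qed

text \<open>In the first \<open>k\<close> columns, the only entry below row \<open>k - 1\<close>
  (0-based) that may be nonzero sits at \<open>(k, k - 1)\<close>. For \<open>k = m\<close> that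
  index is out of range, but the appended vector then has length 0.\<close>

lemma upper_hessenberg_mult_pad_zero:
  assumes A: "A \<in> carrier_mat m m" "upper_hessenberg A" and k: "1 \<le> k" "k \<le> m"
    and x: "x \<in> carrier_vec k"
  shows "A *\<^sub>v (x @\<^sub>v 0\<^sub>v (m - k))
    = (leading_submat k A *\<^sub>v x) @\<^sub>v (A $$ (k, k - 1) * x $ (k - 1)) \<cdot>\<^sub>v unit_vec (m - k) 0"
proof -
  have "vec (m - k) (\<lambda>i. \<Sum>j<k. A $$ (k + i, j) * x $ j)
      = (A $$ (k, k - 1) * x $ (k - 1)) \<cdot>\<^sub>v unit_vec (m - k) 0" (is "?l = ?r")
  proof (rule eq_vecI)
    fix i assume "i < dim_vec ?r"
    then have i: "i < m - k" by simp
    have zero: "A $$ (k + i, j) = 0" if "j < k" "j \<noteq> k - 1 \<or> i \<noteq> 0" for j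
      using A i k that unfolding upper_hessenberg_def by auto
    have "(\<Sum>j<k. A $$ (k + i, j) * x $ j) = (\<Sum>j\<in>{k - 1}. A $$ (k + i, j) * x $ j)"
      using k zero by (intro sum.mono_neutral_right) auto
    then show "?l $ i = ?r $ i" using i zero[of "k - 1"] k by auto
  qed simp
  then show ?thesis using assms by (simp add: mult_mat_vec_pad_zero)
qed

lemma Btilde_mult_append:
  assumes "a \<in> carrier_vec k" "b \<in> carrier_vec k"
  shows "Btilde k M T *\<^sub>v (a @\<^sub>v b) = (leading_submat k M *\<^sub>v b) @\<^sub>v (leading_submat k T *\<^sub>v a)"
proof -
  have l: "leading_submat k A \<in> carrier_mat k k" for A by (simp add: leading_submat_def)
  have "Btilde k M T *\<^sub>v (a @\<^sub>v b) = (0\<^sub>m k k *\<^sub>v a + leading_submat k M *\<^sub>v b)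
      @\<^sub>v (leading_submat k T *\<^sub>v a + 0\<^sub>m k k *\<^sub>v b)"
    unfolding Btilde_def by (rule four_block_mat_mult_vec[of _ k k _ k _ k]) (use l assms in auto)
  also have "0\<^sub>m k k *\<^sub>v a + leading_submat k M *\<^sub>v b = leading_submat k M *\<^sub>v b"
    using l assms by (intro eq_vecI) (auto simp: leading_submat_def)
  also have "leading_submat k T *\<^sub>v a + 0\<^sub>m k k *\<^sub>v b = leading_submat k T *\<^sub>v a"
    using l assms by (intro eq_vecI) (auto simp: leading_submat_def)
  finally show ?thesis .
qed

lemma Btilde_carrier: "Btilde k M T \<in> carrier_mat (2 * k) (2 * k)"
  unfolding Btilde_def mult_2 by (rule four_block_carrier_mat) auto

lemma leading_submat_full: "A \<in> carrier_mat m m \<Longrightarrow> leading_submat m A = A"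
  by (auto simp: leading_submat_def)

text \<open>Only the subdiagonal entry of the Hessenberg factor couples the leading blocks to the rest.\<close>

lemma Btilde_residual:
  assumes M: "M \<in> carrier_mat m m" "upper_triangular M"
    and T: "T \<in> carrier_mat m m" "upper_hessenberg T"
    and k: "1 \<le> k" "k \<le> m" and x: "x \<in> carrier_vec k" and y: "y \<in> carrier_vec k"
    and ev: "Btilde k M T *\<^sub>v (x @\<^sub>v y) = \<theta> \<cdot>\<^sub>v (x @\<^sub>v y)"
  shows "Btilde m M T *\<^sub>v (x @\<^sub>v 0\<^sub>v (m - k) @\<^sub>v y @\<^sub>v 0\<^sub>v (m - k))
      - \<theta> \<cdot>\<^sub>v (x @\<^sub>v 0\<^sub>v (m - k) @\<^sub>v y @\<^sub>v 0\<^sub>v (m - k))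
    = 0\<^sub>v k @\<^sub>v 0\<^sub>v (m - k) @\<^sub>v 0\<^sub>v k @\<^sub>v (T $$ (k, k - 1) * x $ (k - 1)) \<cdot>\<^sub>v unit_vec (m - k) 0"
    (is "_ = 0\<^sub>v k @\<^sub>v 0\<^sub>v (m - k) @\<^sub>v 0\<^sub>v k @\<^sub>v ?d")
proof -
  have c: "leading_submat k M *\<^sub>v y \<in> carrier_vec k" "\<theta> \<cdot>\<^sub>v x \<in> carrier_vec k"
    using x by (auto simp: leading_submat_def intro!: carrier_vecI)
  have "(leading_submat k M *\<^sub>v y) @\<^sub>v (leading_submat k T *\<^sub>v x) = (\<theta> \<cdot>\<^sub>v x) @\<^sub>v (\<theta> \<cdot>\<^sub>v y)"
    using ev unfolding Btilde_mult_append[OF x y] smult_append_vec .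
  then have lead: "leading_submat k M *\<^sub>v y = \<theta> \<cdot>\<^sub>v x" "leading_submat k T *\<^sub>v x = \<theta> \<cdot>\<^sub>v y"
    unfolding append_vec_eq[OF c] by blast+
  have pad: "u @\<^sub>v 0\<^sub>v (m - k) \<in> carrier_vec m" if "u \<in> carrier_vec k" for u :: "complex vec"
    using append_carrier_vec[OF that zero_carrier_vec[of "m - k"]] k by simp
  have "Btilde m M T *\<^sub>v ((x @\<^sub>v 0\<^sub>v (m - k)) @\<^sub>v (y @\<^sub>v 0\<^sub>v (m - k)))
      = (M *\<^sub>v (y @\<^sub>v 0\<^sub>v (m - k))) @\<^sub>v (T *\<^sub>v (x @\<^sub>v 0\<^sub>v (m - k)))"
    unfolding Btilde_mult_append[OF pad[OF x] pad[OF y]]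
      leading_submat_full[OF M(1)] leading_submat_full[OF T(1)] ..
  also have "\<dots> = (\<theta> \<cdot>\<^sub>v x @\<^sub>v 0\<^sub>v (m - k)) @\<^sub>v (\<theta> \<cdot>\<^sub>v y @\<^sub>v ?d)"
    by (simp only: upper_triangular_mult_pad_zero[OF M k(2) y] lead
        upper_hessenberg_mult_pad_zero[OF T k x])
  finally show ?thesis
    unfolding append_vec_assoc using x y
    by (simp only:) (intro eq_vecI; auto)
qed

text \<open>The row equation is applied to \<open>z\<close> after identifying \<open>q^* B\<close>
  with the conjugate of \<open>mat_adjoint B *\<^sub>v q\<close>. The second argument of the product
  is conjugated, so \<open>\<theta>\<close> appears without conjugation.\<close>

lemma cscalar_prod_left_residual:
  fixes B :: "complex mat"
  assumes B: "B \<in> carrier_mat N N" and q: "q \<in> carrier_vec N" and s: "s \<in> carrier_vec N"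
    and eq: "mat_of_rows N [conjugate s]
      = mat_of_rows N [conjugate q] * B - \<theta> \<cdot>\<^sub>m mat_of_rows N [conjugate q]"
    and z: "z \<in> carrier_vec N"
  shows "z \<bullet>c s = (B *\<^sub>v z) \<bullet>c q - \<theta> * (z \<bullet>c q)"
proof -
  have Bq: "mat_adjoint B *\<^sub>v q \<in> carrier_vec N"
    using mult_mat_vec_carrier[OF mat_adjoint_carrier[OF B] q] .
  have "conjugate s = conjugate (mat_adjoint B *\<^sub>v q) - \<theta> \<cdot>\<^sub>v conjugate q"
  proof (rule eq_vecI)
    fix j assume "j < dim_vec (conjugate (mat_adjoint B *\<^sub>v q) - \<theta> \<cdot>\<^sub>v conjugate q)"
    then have j: "j < N" using q by simp
    have "conjugate s $ j = (mat_of_rows N [conjugate q] * B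
        - \<theta> \<cdot>\<^sub>m mat_of_rows N [conjugate q]) $$ (0, j)"
      unfolding eq[symmetric] using j by (simp add: mat_of_rows_index)
    also have "\<dots> = conjugate q \<bullet> col B j - \<theta> * conjugate q $ j"
      using j B q by (simp add: mat_of_rows_index)
    also have "conjugate q \<bullet> col B j = conjugate ((mat_adjoint B *\<^sub>v q) $ j)"
      using index_mat_adjoint_mult_vec[OF B q j] cscalar_prod_commute[OF q, of "col B j"] B q j
        comm_scalar_prod[of "col B j" N "conjugate q"] by simp
    finally show "conjugate s $ j = (conjugate (mat_adjoint B *\<^sub>v q) - \<theta> \<cdot>\<^sub>v conjugate q) $ j"
      using j B q by (simp del: index_mult_mat_vec)
  qed (use s q in auto)
  then have "z \<bullet>c s = z \<bullet>c (mat_adjoint B *\<^sub>v q) - \<theta> * (z \<bullet>c q)"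
    using z q Bq by (simp add: scalar_prod_minus_distrib[of _ N])
  then show ?thesis by (simp add: cscalar_prod_mult_mat_vec[OF B z q])
qed

text \<open>Two degenerate cases are spelled out. Division by 0 yields 0, so for
  \<open>vnorm s = 0\<close> the infinite bound on \<open>r\<close> is stated as a separate
  alternative. For \<open>vnorm r = 0\<close> no nonnegative \<open>\<tau>\<close> satisfies the
  strict bound, and \<open>\<tau> = 0\<close> takes its place.\<close>

theorem proposition6p1:
  fixes n m k :: nat
    and f :: "complex \<Rightarrow> complex"
    and A U V M T G1 G2 Y B' :: "complex mat"
    and v x y qt s r :: "complex vec"
    and t \<theta>k tk :: complex
    and \<delta> :: real
  assumes "A \<in> carrier_mat n n"
    and "mat_fun_well_defined f A"
    and "inexact_lanczos_bidiag n m (mat_fun f A) U V v M T t G1 G2"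
    and "1 \<le> k" and "k \<le> m"
    and "x \<in> carrier_vec k" and "y \<in> carrier_vec k"
    and "eigenvector (Btilde k M T) (x @\<^sub>v y) \<theta>k"
    and "vnorm (x @\<^sub>v y) = 1"
    and "qt = x @\<^sub>v 0\<^sub>v (m - k) @\<^sub>v y @\<^sub>v 0\<^sub>v (m - k)"
    and "Y \<in> carrier_mat (2 * m) (2 * m - 1)"
    and "unitary_mat (mat_of_cols (2 * m) (qt # cols Y))"
    and "B' = mat_adjoint Y * Btilde m M T * Y"
    and "s \<in> carrier_vec (2 * m)"
    and "mat_of_rows (2 * m) [conjugate s]
           = mat_of_rows (2 * m) [conjugate qt] * Btilde m M T
             - \<theta>k \<cdot>\<^sub>m mat_of_rows (2 * m) [conjugate qt]"
    and "\<delta> = sigma_min (B' - \<theta>k \<cdot>\<^sub>m 1\<^sub>m (2 * m - 1))"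
    and "\<delta> > 0"
    and "tk = (if k < m then T $$ (k, k - 1) else t)"
    and "r = (tk * ((x @\<^sub>v y) \<bullet>c unit_vec (2 * k) (k - 1))) \<cdot>\<^sub>v (0\<^sub>v n @\<^sub>v ((cols V @ [v]) ! k))"
    and "vnorm s = 0 \<or> vnorm r < \<delta>\<^sup>2 / (4 * vnorm s)"
  shows "\<exists>x1 x2 y1 y2 \<theta> \<tau>.
           x1 \<in> carrier_vec k \<and> x2 \<in> carrier_vec (m - k)
           \<and> y1 \<in> carrier_vec k \<and> y2 \<in> carrier_vec (m - k)
           \<and> vnorm (x1 @\<^sub>v x2 @\<^sub>v y1 @\<^sub>v y2) = 1
           \<and> eigenvector (Btilde m M T) (x1 @\<^sub>v x2 @\<^sub>v y1 @\<^sub>v y2) \<theta>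
           \<and> 0 \<le> \<tau> \<and> (\<tau> < 2 * vnorm r / \<delta> \<or> (vnorm r = 0 \<and> \<tau> = 0))
           \<and> vnorm (x2 @\<^sub>v y2) \<le> \<tau> / sqrt (1 + \<tau>\<^sup>2)
           \<and> cmod (\<theta> - \<theta>k) \<le> vnorm s * \<tau>"
proof -
  have M: "M \<in> carrier_mat m m" "upper_triangular M" and T: "T \<in> carrier_mat m m" "upper_hessenberg T"
    and V: "V \<in> carrier_mat n m" and v: "v \<in> carrier_vec n"
    and orthV: "orthonormal_cols (mat_of_cols n (cols V @ [v]))"
    using assms(3) unfolding inexact_lanczos_bidiag_def by auto
  note k = assms(4,5) and x = assms(6) and y = assms(7)
  define B where "B = Btilde m M T"
  have B: "B \<in> carrier_mat (2 * m) (2 * m)" unfolding B_def by (rule Btilde_carrier)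
  have qt: "qt \<in> carrier_vec (2 * m)" using assms(10) x y k by (auto intro!: carrier_vecI)
  have ev: "Btilde k M T *\<^sub>v (x @\<^sub>v y) = \<theta>k \<cdot>\<^sub>v (x @\<^sub>v y)"
    using assms(8) unfolding eigenvector_def by simp
  let ?d = "(T $$ (k, k - 1) * x $ (k - 1)) \<cdot>\<^sub>v unit_vec (m - k) 0"
  have res: "B *\<^sub>v qt - \<theta>k \<cdot>\<^sub>v qt = 0\<^sub>v k @\<^sub>v 0\<^sub>v (m - k) @\<^sub>v 0\<^sub>v k @\<^sub>v ?d"
    unfolding B_def assms(10) by (rule Btilde_residual[OF M T k x y ev])
  \<comment> \<open>The only block in which the residual may be nonzero is the fourth, where
    \<open>qt\<close> is padded with zeros.\<close>
  have res_orth: "(B *\<^sub>v qt - \<theta>k \<cdot>\<^sub>v qt) \<bullet>c qt = 0"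
    unfolding res unfolding assms(10) using x y by (simp add: cscalar_prod_append)
  \<comment> \<open>Column \<open>k\<close> in 0-based counting is the unit vector written
    \<open>v_{k+1}\<close> in the text, and the unit vector with index \<open>k - 1\<close> picks
    the last entry of \<open>x\<close>.\<close>
  have "vnorm r = cmod (tk * x $ (k - 1))"
  proof -
    define W where "W = mat_of_cols n (cols V @ [v])"
    have kW: "k < dim_col W" using V k by (simp add: W_def)
    have colW: "col W k = (cols V @ [v]) ! k"
      unfolding W_def using V v k by (intro col_mat_of_cols) (auto simp: nth_append cols_def)
    have "col W k \<bullet>c col W k = 1"
      using orthV kW index_mat_adjoint_mult_self[OF kW kW]
      unfolding orthonormal_cols_def W_def[symmetric] by simp
    then have "(vnorm (col W k))\<^sup>2 = 1" unfolding cscalar_prod_self by (metis of_real_eq_1_iff)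
    then have "(vnorm (0\<^sub>v n @\<^sub>v (cols V @ [v]) ! k))\<^sup>2 = 1"
      unfolding vnorm_append_power2 colW by simp
    then have "vnorm (0\<^sub>v n @\<^sub>v (cols V @ [v]) ! k) = 1" by (simp add: power2_eq_1_iff)
        (use vnorm_nonneg in \<open>metis neg_0_le_iff_le not_one_le_zero\<close>)
    moreover have "(x @\<^sub>v y) \<bullet>c unit_vec (2 * k) (k - 1) = x $ (k - 1)"
    proof -
      have "conjugate (unit_vec (2 * k) (k - 1)) = (unit_vec (2 * k) (k - 1) :: complex vec)"
        by (intro eq_vecI) auto
      moreover have "x @\<^sub>v y \<in> carrier_vec (2 * k)" using x y by (auto intro!: carrier_vecI)
      ultimately show ?thesis using x y k by simp
    qed
    ultimately show ?thesis unfolding assms(19) by simp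
  qed
  moreover have "vnorm (B *\<^sub>v qt - \<theta>k \<cdot>\<^sub>v qt) = vnorm ?d"
    unfolding res by (rule power2_eq_imp_eq) (simp_all only: vnorm_append_power2 vnorm_zero, simp_all)
  moreover have "vnorm ?d \<le> cmod (tk * x $ (k - 1))"
  proof (cases "k < m")
    case True
    then show ?thesis using assms(18) by (simp add: vnorm_unit_vec)
  next
    \<comment> \<open>For \<open>k = m\<close> the residual is exactly 0, whereas \<open>r\<close>
      is built from \<open>t\<close> and may be nonzero; only an inequality holds.\<close>
    case False
    then have "vnorm ?d = 0" by (simp add: vnorm_def)
    then show ?thesis by (metis norm_ge_zero)
  qed
  ultimately have res_le: "vnorm (B *\<^sub>v qt - \<theta>k \<cdot>\<^sub>v qt) \<le> vnorm r" by linarith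
  have small: "4 * vnorm r * vnorm s < \<delta>\<^sup>2"
  proof (cases "vnorm s = 0")
    case True
    then show ?thesis using assms(17) by simp
  next
    case False
    then have "vnorm s > 0" using vnorm_nonneg[of s] by linarith
    then show ?thesis using assms(20) by (simp add: field_simps)
  qed
  \<comment> \<open>Here \<open>1 \<le> k \<le> m\<close> ensures that the dimension
    \<open>2 * m - 1\<close> is positive.\<close>
  have low: "\<delta> * vnorm p
      \<le> vnorm ((mat_adjoint Y * B * Y - \<theta>k \<cdot>\<^sub>m 1\<^sub>m (2 * m - 1)) *\<^sub>v p)"
    if "p \<in> carrier_vec (2 * m - 1)" for p
    unfolding assms(16) assms(13) B_def using k that
    by (intro sigma_min_mult_vnorm_le[of _ "2 * m - 1" "2 * m - 1"])
      (auto intro!: minus_carrier_mat smult_carrier_mat)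
  obtain p where p: "p \<in> carrier_vec (2 * m - 1)" "vnorm (Y *\<^sub>v p) = vnorm p"
    and orth: "(Y *\<^sub>v p) \<bullet>c qt = 0"
    and eig: "B *\<^sub>v (qt + Y *\<^sub>v p) = (\<theta>k + (Y *\<^sub>v p) \<bullet>c s) \<cdot>\<^sub>v (qt + Y *\<^sub>v p)"
    and bound: "vnorm p < 2 * vnorm r / \<delta> \<or> (vnorm r = 0 \<and> vnorm p = 0)"
    using perturbed_eigenvector[OF B qt assms(11,12,14)
        cscalar_prod_left_residual[OF B qt assms(14,15)[folded B_def]]
        res_orth res_le assms(17) low small] by blast
  define z where "z = Y *\<^sub>v p"
  define \<tau> where "\<tau> = vnorm p"
  define \<theta> where "\<theta> = \<theta>k + z \<bullet>c s"
  \<comment> \<open>\<open>qt\<close> has norm 1 and is orthogonal to \<open>z\<close>, whose norm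
    is \<open>\<tau>\<close>; by Pythagoras \<open>c\<close> is the norm of \<open>qt + z\<close>,
    and \<open>a\<close> normalises it.\<close>
  define c where "c = sqrt (1 + \<tau>\<^sup>2)"
  define a where "a = complex_of_real (1 / c)"
  have z: "z \<in> carrier_vec (2 * m)" using assms(11) p by (simp add: z_def)
  have z\<tau>: "vnorm z = \<tau>" using p by (simp add: z_def \<tau>_def)
  have c: "0 < c" "c\<^sup>2 = 1 + \<tau>\<^sup>2" by (simp_all add: c_def add_pos_nonneg)
  have a: "a \<noteq> 0" "cmod a = 1 / c" using c by (simp_all add: a_def norm_divide)
  have dims: "2 * m = k + ((m - k) + (k + (m - k)))" using k by simp
  obtain z1 z2 z3 z4 where zs: "z1 \<in> carrier_vec k" "z2 \<in> carrier_vec (m - k)"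
    "z3 \<in> carrier_vec k" "z4 \<in> carrier_vec (m - k)" and z_eq: "z = z1 @\<^sub>v z2 @\<^sub>v z3 @\<^sub>v z4"
  proof -
    have split: "\<exists>u w. u \<in> carrier_vec i \<and> w \<in> carrier_vec j \<and> t = u @\<^sub>v w"
      if "t \<in> carrier_vec (i + j)" for t :: "complex vec" and i j
      using vec_first_last_append[OF that] vec_first_carrier vec_last_carrier by metis
    show thesis using split[OF z[unfolded dims]] split that by metis
  qed
  define q where "q = a \<cdot>\<^sub>v (qt + z)"
  have q_eq: "q = a \<cdot>\<^sub>v (x + z1) @\<^sub>v a \<cdot>\<^sub>v z2 @\<^sub>v a \<cdot>\<^sub>v (y + z3) @\<^sub>v a \<cdot>\<^sub>v z4"
  proof -
    have "qt + z = (x + z1) @\<^sub>v z2 @\<^sub>v (y + z3) @\<^sub>v z4"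
      unfolding assms(10) z_eq using x y zs by (intro eq_vecI) auto
    then show ?thesis by (simp add: q_def smult_append_vec)
  qed
  have "(vnorm qt)\<^sup>2 = 1"
    using assms(9) vnorm_append_power2[of x y] by (simp add: assms(10) vnorm_append_power2)
  moreover have "Re (qt \<bullet>c z) = 0"
    using cscalar_prod_commute[OF z qt] orth by (simp add: z_def)
  ultimately have "(vnorm (qt + z))\<^sup>2 = c\<^sup>2"
    by (simp add: vnorm_add_power2[OF qt z] z\<tau> c(2))
  then have norm_qz: "vnorm (qt + z) = c" using c(1) by simp
  then have norm_q: "vnorm q = 1" using c by (simp add: q_def a)
  have q: "q \<in> carrier_vec (2 * m)" using qt z by (simp add: q_def)
  have "B *\<^sub>v q = \<theta> \<cdot>\<^sub>v q"
    using eig[folded z_def, folded \<theta>_def] mult_mat_vec[OF B, of "qt + z" a] qt z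
    by (simp add: q_def smult_smult_assoc mult.commute)
  moreover have "q \<noteq> 0\<^sub>v (2 * m)" using norm_q by auto
  ultimately have ev_q: "eigenvector (Btilde m M T) q \<theta>"
    using q B unfolding eigenvector_def B_def by auto
  \<comment> \<open>In the second and fourth blocks \<open>qt\<close> vanishes, so only
    \<open>z\<close> contributes, with norm at most \<open>\<tau>\<close> before scaling by
    \<open>1 / c\<close>.\<close>
  have small_part: "vnorm (a \<cdot>\<^sub>v z2 @\<^sub>v a \<cdot>\<^sub>v z4) \<le> \<tau> / c"
  proof (rule power2_le_imp_le)
    have "(vnorm z2)\<^sup>2 + (vnorm z4)\<^sup>2 \<le> (vnorm z)\<^sup>2"
      unfolding z_eq vnorm_append_power2 by simp
    then have "((vnorm z2)\<^sup>2 + (vnorm z4)\<^sup>2) / c\<^sup>2 \<le> \<tau>\<^sup>2 / c\<^sup>2"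
      unfolding z\<tau> by (simp add: divide_right_mono)
    then show "(vnorm (a \<cdot>\<^sub>v z2 @\<^sub>v a \<cdot>\<^sub>v z4))\<^sup>2 \<le> (\<tau> / c)\<^sup>2"
      by (simp add: vnorm_append_power2 a power_divide add_divide_distrib power_mult_distrib)
    show "0 \<le> \<tau> / c" using c by (simp add: \<tau>_def)
  qed
  have "cmod (\<theta> - \<theta>k) \<le> vnorm s * \<tau>"
    using cmod_cscalar_prod_le[OF z assms(14)] by (simp add: \<theta>_def z\<tau> mult.commute)
  then show ?thesis
    using x y zs norm_q ev_q small_part bound unfolding q_eq c_def \<tau>_def[symmetric]
    by (intro exI[of _ "a \<cdot>\<^sub>v (x + z1)"] exI[of _ "a \<cdot>\<^sub>v z2"] exI[of _ "a \<cdot>\<^sub>v (y + z3)"]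
        exI[of _ "a \<cdot>\<^sub>v z4"] exI[of _ \<theta>] exI[of _ \<tau>]) (auto simp: \<tau>_def)
qed

end
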